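(* Let $(\Omega,\rightarrow)$ be a finite semigroup. For any $n\geqslant 1$, put $\mathbf{P}(n)=(\mathbb{K}\Omega)^{\otimes n}$, whose elements are linear combinations of words $\alpha_1\ldots\alpha_n$ in $\Omega$. Then $\mathbf{P}=(\mathbf{P}(n))_{n\geqslant 1}$ is a nonsymmetric operad with the following composition: for any $\alpha_1,\ldots,\alpha_n\in\Omega$ and any $\beta_{i,j}\in\Omega$, $$\alpha_1\ldots\alpha_n\circ(\beta_{1,1}\ldots\beta_{1,k_1},\ldots,\beta_{n,1}\ldots\beta_{n,k_n})=\left(\prod_{i=1}^n\delta_{\alpha_i,\,\beta_{i,1}\rightarrow\cdots\rightarrow\beta_{i,k_i}}\right)\beta_{1,1}\ldots\beta_{1,k_1}\ldots\beta_{n,1}\ldots\beta_{n,k_n},$$ with unit $I=\sum_{\alpha\in\Omega}\alpha\in\mathbf{P}(1)$. Moreover, $\mathbf{P}_0(1)=\mathbb{K}I$ and $\mathbf{P}_0(n)=\mathbf{P}(n)$ for $n\geqslant 2$ define a suboperad $\mathbf{P}_0$ of $\mathbf{P}$ which is isomorphic to the Koszul dual $(\mathbf{As}_\Omega^2)^!$ of $\mathbf{As}_\Omega^2$.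
   Context: $\mathbb{K}$ is a commutative field; operads are operads in $\mathbb{K}$-vector spaces; $\delta$ is the Kronecker symbol and $\mathbb{K}\Omega$ is the vector space with basis $\Omega$. $\mathbf{As}_\Omega^2$ is the nonsymmetric operad generated by binary operations $*_{\alpha,\beta}$ (linearly independent, $(\alpha,\beta)\in\Omega^2$) with the relations $*_{\alpha\rightarrow\beta,\gamma}\circ_1 *_{\alpha,\beta}=*_{\alpha,\beta\rightarrow\gamma}\circ_2 *_{\beta,\gamma}$ for all $\alpha,\beta,\gamma\in\Omega$. Koszul dual convention: for a nonsymmetric binary quadratic operad $\mathbf{F}(E)/(R)$, with $E$ finite-dimensional and $R\subseteq \mathbf{F}(E)(3)$, the Koszul dual is $\mathbf{F}(E^* )/(R^\perp)$, where $\langle f\circ_1g,a\circ_1b\rangle=f(a)g(b)$, $\langle f\circ_2g,a\circ_2b\rangle=-f(a)g(b)$, and the other pairings are zero. *)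

theory Defs
  imports
    "Jordan_Normal_Form.VS_Connect"
    "HOL-Algebra.AbelCoset"
    "HOL-Library.Poly_Mapping"
    "HOL-Library.Tree"
begin

section \<open>Nonsymmetric operads in vector spaces\<close>

text \<open>
  The component of arity \<open>n\<close> is a vector space in the sense of \<^const>\<open>vectorspace\<close>, with
  scalars in a type of class \<^class>\<open>field\<close>.  In \<open>compo P [k\<^sub>1, \<dots>, k\<^sub>n] x [y\<^sub>1, \<dots>, y\<^sub>n]\<close>, which
  stands for \<open>x \<circ> (y\<^sub>1, \<dots>, y\<^sub>n)\<close>, the list of arities of the \<open>y\<^sub>i\<close> is an explicit argument because the
  components need not be disjoint.  Only the arities \<open>n \<ge> 1\<close> are meaningful; nothing is required of the
  component of index \<open>0\<close>.
\<close>

record ('k, 'a) nsop =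
  comps :: "nat \<Rightarrow> ('k, 'a) module"
  compo :: "nat list \<Rightarrow> 'a \<Rightarrow> 'a list \<Rightarrow> 'a"
  oper_unit :: "'a"

definition valid_arities :: "nat list \<Rightarrow> bool" where
  "valid_arities ks \<longleftrightarrow> ks \<noteq> [] \<and> (\<forall>k\<in>set ks. 1 \<le> k)"

definition inputs :: "('k, 'a) nsop \<Rightarrow> nat list \<Rightarrow> 'a list \<Rightarrow> bool" where
  "inputs P ks ys \<longleftrightarrow> list_all2 (\<lambda>k y. y \<in> carrier (comps P k)) ks ys"

locale ns_operad =
  fixes P :: "('k::field, 'a) nsop"
  assumes vectorspace_comps: "1 \<le> n \<Longrightarrow> vectorspace class_ring (comps P n)"
    and unit_closed: "oper_unit P \<in> carrier (comps P 1)"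
    and linear_outer: "\<lbrakk>valid_arities ks; inputs P ks ys\<rbrakk> \<Longrightarrow>
      (\<lambda>x. compo P ks x ys) \<in> LinearCombinations.module_hom class_ring (comps P (length ks)) (comps P (sum_list ks))"
    and linear_inner: "\<lbrakk>valid_arities ks; x \<in> carrier (comps P (length ks)); inputs P ks ys; i < length ks\<rbrakk> \<Longrightarrow>
      (\<lambda>y. compo P ks x (ys[i := y])) \<in> LinearCombinations.module_hom class_ring (comps P (ks ! i)) (comps P (sum_list ks))"
    and unit_left: "\<lbrakk>1 \<le> k; y \<in> carrier (comps P k)\<rbrakk> \<Longrightarrow> compo P [k] (oper_unit P) [y] = y"
    and unit_right: "\<lbrakk>1 \<le> n; x \<in> carrier (comps P n)\<rbrakk> \<Longrightarrow>
      compo P (replicate n 1) x (replicate n (oper_unit P)) = x"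
    and assoc: "\<lbrakk>kss \<noteq> []; \<forall>ks\<in>set kss. valid_arities ks;
        x \<in> carrier (comps P (length kss)); inputs P (map length kss) ys; list_all2 (inputs P) kss zss\<rbrakk> \<Longrightarrow>
      compo P (concat kss) (compo P (map length kss) x ys) (concat zss) =
      compo P (map sum_list kss) x (map2 (\<lambda>ks (y, zs). compo P ks y zs) kss (zip ys zss))"

text \<open>The partial composition \<open>x \<circ>\<^sub>i y\<close> for \<open>x\<close> of arity \<open>n\<close> and \<open>y\<close> of arity \<open>k\<close>, where \<open>1 \<le> i \<le> n\<close>.\<close>

definition circ :: "('k, 'a) nsop \<Rightarrow> nat \<Rightarrow> nat \<Rightarrow> nat \<Rightarrow> 'a \<Rightarrow> 'a \<Rightarrow> 'a" where
  "circ P n k i x y =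
     compo P ((replicate n 1)[i - 1 := k]) x ((replicate n (oper_unit P))[i - 1 := y])"

locale operad_iso = P: ns_operad P + Q: ns_operad Q
  for P :: "('k::field, 'a) nsop" and Q :: "('k, 'b) nsop" +
  fixes \<phi> :: "nat \<Rightarrow> 'a \<Rightarrow> 'b"
  assumes hom: "1 \<le> n \<Longrightarrow> \<phi> n \<in> LinearCombinations.module_hom class_ring (comps P n) (comps Q n)"
    and bij: "1 \<le> n \<Longrightarrow> bij_betw (\<phi> n) (carrier (comps P n)) (carrier (comps Q n))"
    and unit: "\<phi> 1 (oper_unit P) = oper_unit Q"
    and compo: "\<lbrakk>valid_arities ks; x \<in> carrier (comps P (length ks)); inputs P ks ys\<rbrakk> \<Longrightarrow>
      \<phi> (sum_list ks) (compo P ks x ys) = compo Q ks (\<phi> (length ks) x) (map2 \<phi> ks ys)"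

definition operad_isomorphic :: "('k::field, 'a) nsop \<Rightarrow> ('k, 'b) nsop \<Rightarrow> bool" where
  "operad_isomorphic P Q \<longleftrightarrow> (\<exists>\<phi>. operad_iso P Q \<phi>)"

definition suboperad :: "('k::field, 'a) nsop \<Rightarrow> (nat \<Rightarrow> 'a set) \<Rightarrow> bool" where
  "suboperad P S \<longleftrightarrow>
     (\<forall>n\<ge>1. VectorSpace.subspace class_ring (S n) (comps P n)) \<and>
     oper_unit P \<in> S 1 \<and>
     (\<forall>ks x ys. valid_arities ks \<and> x \<in> S (length ks) \<and> list_all2 (\<lambda>k y. y \<in> S k) ks ys \<longrightarrow>
        compo P ks x ys \<in> S (sum_list ks))"

definition restrict_operad :: "('k, 'a) nsop \<Rightarrow> (nat \<Rightarrow> 'a set) \<Rightarrow> ('k, 'a) nsop" where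
  "restrict_operad P S = P\<lparr>comps := (\<lambda>n. comps P n\<lparr>carrier := S n\<rparr>)\<rparr>"


section \<open>Ideals and quotients\<close>

definition operad_ideal :: "('k::field, 'a) nsop \<Rightarrow> (nat \<Rightarrow> 'a set) \<Rightarrow> bool" where
  "operad_ideal P J \<longleftrightarrow>
     (\<forall>n\<ge>1. VectorSpace.subspace class_ring (J n) (comps P n)) \<and>
     (\<forall>ks x ys. valid_arities ks \<and> x \<in> carrier (comps P (length ks)) \<and> inputs P ks ys \<and>
        (x \<in> J (length ks) \<or> (\<exists>i<length ks. ys ! i \<in> J (ks ! i))) \<longrightarrow>
        compo P ks x ys \<in> J (sum_list ks))"

definition ideal_generated :: "('k::field, 'a) nsop \<Rightarrow> (nat \<Rightarrow> 'a set) \<Rightarrow> nat \<Rightarrow> 'a set" where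
  "ideal_generated P G n = \<Inter>{J n | J. operad_ideal P J \<and> (\<forall>m\<ge>1. G m \<subseteq> J m)}"

text \<open>
  Operations on cosets are performed on all representatives at once; the unions are unions of equal
  cosets when \<open>W\<close> is a subspace and \<open>J\<close> is an ideal.  The ring fields \<^const>\<open>mult\<close> and
  \<^const>\<open>one\<close> of the record type of modules play no role here or below.
\<close>

definition quotient_space :: "('k, 'a) module \<Rightarrow> 'a set \<Rightarrow> ('k, 'a set) module" where
  "quotient_space V W =
     \<lparr>carrier = a_rcosets\<^bsub>V\<^esub> W, mult = undefined, one = undefined,
      zero = W, add = set_add V,
      smult = (\<lambda>c A. \<Union>x\<in>A. W +>\<^bsub>V\<^esub> (c \<odot>\<^bsub>V\<^esub> x))\<rparr>"

definition quotient_operad :: "('k, 'a) nsop \<Rightarrow> (nat \<Rightarrow> 'a set) \<Rightarrow> ('k, 'a set) nsop" where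
  "quotient_operad P J =
     \<lparr>comps = (\<lambda>n. quotient_space (comps P n) (J n)),
      compo = (\<lambda>ks A Bs. \<Union>x\<in>A. \<Union>ys\<in>listset Bs.
        J (sum_list ks) +>\<^bsub>comps P (sum_list ks)\<^esub> compo P ks x ys),
      oper_unit = J 1 +>\<^bsub>comps P 1\<^esub> oper_unit P\<rparr>"


section \<open>Vector spaces and operads with a given basis\<close>

abbreviation scale :: "'k::field \<Rightarrow> ('b \<Rightarrow>\<^sub>0 'k) \<Rightarrow> ('b \<Rightarrow>\<^sub>0 'k)" where
  "scale c \<equiv> Poly_Mapping.map ((*) c)"

definition free_space :: "'b set \<Rightarrow> ('k::field, 'b \<Rightarrow>\<^sub>0 'k) module" where
  "free_space B =
     \<lparr>carrier = {f. Poly_Mapping.keys f \<subseteq> B}, mult = undefined, one = undefined,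
      zero = 0, add = (+), smult = scale\<rparr>"

text \<open>
  Extension to linear combinations, linear in every argument, of a composition \<open>m\<close> given on basis
  elements (for \<open>m b [b\<^sub>1, \<dots>, b\<^sub>n]\<close>, only the \<open>b\<close> and \<open>b\<^sub>i\<close> in the supports matter).
\<close>

definition multilinear_ext ::
    "('b \<Rightarrow> 'b list \<Rightarrow> 'b \<Rightarrow>\<^sub>0 'k) \<Rightarrow> ('b \<Rightarrow>\<^sub>0 'k) \<Rightarrow> ('b \<Rightarrow>\<^sub>0 'k) list \<Rightarrow> ('b \<Rightarrow>\<^sub>0 'k::field)" where
  "multilinear_ext m x ys =
     (\<Sum>b\<in>Poly_Mapping.keys x. \<Sum>bs\<in>listset (map Poly_Mapping.keys ys).
        scale (Poly_Mapping.lookup x b * (\<Prod>i<length ys. Poly_Mapping.lookup (ys ! i) (bs ! i))) (m b bs))"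


section \<open>The free operad on binary operations and Koszul duality\<close>

text \<open>\<open>graft t [t\<^sub>1, \<dots>, t\<^sub>n]\<close> replaces the \<open>n\<close> leaves of \<open>t\<close>, from left to right, by \<open>t\<^sub>1, \<dots>, t\<^sub>n\<close>.\<close>

fun graft :: "'x tree \<Rightarrow> 'x tree list \<Rightarrow> 'x tree" where
  "graft \<langle>\<rangle> ts = hd ts"
| "graft \<langle>l, x, r\<rangle> ts = \<langle>graft l (take (size1 l) ts), x, graft r (drop (size1 l) ts)\<rangle>"

text \<open>
  The free nonsymmetric operad \<open>F(E)\<close> on a space \<open>E\<close> of binary operations with basis \<open>X\<close>: the component
  of arity \<open>n\<close> has as basis the planar binary trees with \<open>n\<close> leaves and internal vertices labelled
  by \<open>X\<close>.
\<close>

definition free_operad :: "'x set \<Rightarrow> ('k::field, 'x tree \<Rightarrow>\<^sub>0 'k) nsop" where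
  "free_operad X =
     \<lparr>comps = (\<lambda>n. free_space {t. size1 t = n \<and> set_tree t \<subseteq> X}),
      compo = (\<lambda>ks. multilinear_ext (\<lambda>t ts. Poly_Mapping.single (graft t ts) 1)),
      oper_unit = Poly_Mapping.single \<langle>\<rangle> 1\<rparr>"

definition generator :: "'x \<Rightarrow> ('x tree \<Rightarrow>\<^sub>0 'k::field)" where
  "generator x = Poly_Mapping.single \<langle>\<langle>\<rangle>, x, \<langle>\<rangle>\<rangle> 1"

text \<open>
  A binary quadratic presentation is a pair \<open>(X, R)\<close> of a basis \<open>X\<close> of \<open>E\<close> and a set \<open>R\<close> of relations in
  \<open>F(E)(3)\<close>; it presents the operad \<open>F(E)/(R)\<close>.
\<close>

definition presented_operad ::
    "'x set \<times> ('x tree \<Rightarrow>\<^sub>0 'k) set \<Rightarrow> ('k::field, ('x tree \<Rightarrow>\<^sub>0 'k) set) nsop" where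
  "presented_operad = (\<lambda>(X, R).
     quotient_operad (free_operad X)
       (ideal_generated (free_operad X) (\<lambda>n. if n = 3 then R else {})))"

text \<open>
  A linear form on the space with basis \<open>X\<close> is identified with the function of its values on \<open>X\<close>; so the
  basis of the dual space dual to \<open>X\<close> consists of the Kronecker functions.
\<close>

definition dual_basis :: "'x set \<Rightarrow> ('x \<Rightarrow> 'k::field) set" where
  "dual_basis X = (\<lambda>x y. if y = x then 1 else 0) ` X"

text \<open>
  \<open>\<langle>\<langle>\<rangle>, g, \<langle>\<rangle>\<rangle>\<close> grafted on the first, respectively second, leaf of \<open>\<langle>\<langle>\<rangle>, f, \<langle>\<rangle>\<rangle>\<close> is
  \<open>f \<circ>\<^sub>1 g\<close>, respectively \<open>f \<circ>\<^sub>2 g\<close>.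
\<close>

fun tree_pairing :: "('x \<Rightarrow> 'k::field) tree \<Rightarrow> 'x tree \<Rightarrow> 'k" where
  "tree_pairing \<langle>\<langle>\<langle>\<rangle>, g, \<langle>\<rangle>\<rangle>, f, \<langle>\<rangle>\<rangle> \<langle>\<langle>\<langle>\<rangle>, b, \<langle>\<rangle>\<rangle>, a, \<langle>\<rangle>\<rangle> = f a * g b"
| "tree_pairing \<langle>\<langle>\<rangle>, f, \<langle>\<langle>\<rangle>, g, \<langle>\<rangle>\<rangle>\<rangle> \<langle>\<langle>\<rangle>, a, \<langle>\<langle>\<rangle>, b, \<langle>\<rangle>\<rangle>\<rangle> = - (f a * g b)"
| "tree_pairing _ _ = 0"

definition pairing :: "(('x \<Rightarrow> 'k) tree \<Rightarrow>\<^sub>0 'k) \<Rightarrow> ('x tree \<Rightarrow>\<^sub>0 'k) \<Rightarrow> 'k::field" where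
  "pairing u v = (\<Sum>s\<in>Poly_Mapping.keys u. \<Sum>t\<in>Poly_Mapping.keys v.
     Poly_Mapping.lookup u s * Poly_Mapping.lookup v t * tree_pairing s t)"

definition orthogonal ::
    "'x set \<Rightarrow> ('x tree \<Rightarrow>\<^sub>0 'k) set \<Rightarrow> (('x \<Rightarrow> 'k::field) tree \<Rightarrow>\<^sub>0 'k) set" where
  "orthogonal X R =
     {u \<in> carrier (comps (free_operad (dual_basis X)) 3). \<forall>v\<in>R. pairing u v = 0}"

definition koszul_dual ::
    "'x set \<times> ('x tree \<Rightarrow>\<^sub>0 'k) set \<Rightarrow> ('k::field, (('x \<Rightarrow> 'k) tree \<Rightarrow>\<^sub>0 'k) set) nsop" where
  "koszul_dual = (\<lambda>(X, R). presented_operad (dual_basis X, orthogonal X R))"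

text \<open>
  The presentation of \<open>As\<^sup>2\<close> over \<open>\<Omega>\<close>: the label \<open>(\<alpha>, \<beta>)\<close> stands for the operation indexed by
  \<open>\<alpha>, \<beta>\<close>, and \<open>arr\<close> for the arrow of \<open>\<Omega>\<close>.
\<close>

definition As2_presentation ::
    "('w \<Rightarrow> 'w \<Rightarrow> 'w) \<Rightarrow> ('w \<times> 'w) set \<times> (('w \<times> 'w) tree \<Rightarrow>\<^sub>0 'k::field) set" where
  "As2_presentation arr =
     (UNIV,
      {circ (free_operad UNIV) 2 2 1 (generator (arr \<alpha> \<beta>, \<gamma>)) (generator (\<alpha>, \<beta>)) -
       circ (free_operad UNIV) 2 2 2 (generator (\<alpha>, arr \<beta> \<gamma>)) (generator (\<beta>, \<gamma>)) | \<alpha> \<beta> \<gamma>. True})"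

definition As2 :: "('w \<Rightarrow> 'w \<Rightarrow> 'w) \<Rightarrow> ('k::field, (('w \<times> 'w) tree \<Rightarrow>\<^sub>0 'k) set) nsop" where
  "As2 arr = presented_operad (As2_presentation arr)"


section \<open>The operad of words\<close>

text \<open>\<open>word_value arr [\<beta>\<^sub>1, \<dots>, \<beta>\<^sub>k] = \<beta>\<^sub>1 \<rightarrow> \<cdots> \<rightarrow> \<beta>\<^sub>k\<close>, for \<open>k \<ge> 1\<close>.\<close>

definition word_value :: "('w \<Rightarrow> 'w \<Rightarrow> 'w) \<Rightarrow> 'w list \<Rightarrow> 'w" where
  "word_value arr bs = foldl arr (hd bs) (tl bs)"

text \<open>The space with basis the words of length \<open>n\<close> in \<open>\<Omega>\<close> is the \<open>n\<close>-th tensor power of \<open>\<bbbK>\<Omega>\<close>.\<close>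

definition word_operad :: "('w::finite \<Rightarrow> 'w \<Rightarrow> 'w) \<Rightarrow> ('k::field, 'w list \<Rightarrow>\<^sub>0 'k) nsop" where
  "word_operad arr =
     \<lparr>comps = (\<lambda>n. free_space {w. length w = n}),
      compo = (\<lambda>ks. multilinear_ext (\<lambda>as bss. Poly_Mapping.single (concat bss)
        (\<Prod>i<length as. of_bool (as ! i = word_value arr (bss ! i))))),
      oper_unit = (\<Sum>\<alpha>\<in>UNIV. Poly_Mapping.single [\<alpha>] 1)\<rparr>"

definition word_suboperad :: "('w::finite \<Rightarrow> 'w \<Rightarrow> 'w) \<Rightarrow> nat \<Rightarrow> ('w list \<Rightarrow>\<^sub>0 'k::field) set" where
  "word_suboperad arr n =
     (if n = 1 then {scale c (oper_unit (word_operad arr)) | c. True}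
      else carrier (comps (word_operad arr) n))"

end

(*
  A tree labelled by dual generators (a, b) is sent to the word whose value at every internal vertex
  is the label of that vertex, if there is such a word, and to 0 otherwise; the trivial tree is sent
  to the sum of all letters, which is the unit. This is a morphism from the free operad onto P_0, and
  in arity 3 its kernel is exactly the orthogonal of the relations of As^2. Modulo the ideal
  generated by this orthogonal, a tree that carries a word is congruent to the right comb carrying
  the same word, and all other trees vanish. Distinct words of length at least 2 have distinct right
  combs, so the kernel is that ideal in every arity.

  The axioms of P are checked on coefficients: the coefficient of x o (y_1, ..., y_n) at a word cut
  into blocks w_1 ... w_n is that of x at the word of the values of the w_i, times the product of the
  coefficients of y_i at w_i.
*)

theory Submission
  imports Defs
begin

section \<open>Linear combinations\<close>

text \<open>Two signs explain why the orthogonal is a kernel: the relation of a word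
  \<open>\<alpha> \<beta> \<gamma>\<close> is a difference, the pairing is negative on second-leaf
  compositions, and together they make the pairing with that relation the coefficient of the word in
  the image. A tree without a word vanishes because a contradiction between labels can be brought to
  a single edge: when both subtrees of the root carry words, reducing them to right combs leaves the
  root in conflict with the top vertex of a comb, and such a pair of vertices already lies in the
  orthogonal. In arity 1 the trivial tree carries every letter, so words are not unique there and
  only the multiples of the unit are reached; this is why P_0 can differ from P only in that arity.
  The obstacle on the formal side is the quotient: its operations are unions over representatives,
  and neither it nor the free operad is known to be an operad. The axioms are therefore proved only
  for P, restricted to P_0, and carried to the quotient along the map that sends an element to its
  fibre.\<close>

lemma lookup_scale [simp]: "Poly_Mapping.lookup (scale c x) b = c * Poly_Mapping.lookup x b"
  by (simp add: Poly_Mapping.map.rep_eq when_def)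

lemma keys_scale: "Poly_Mapping.keys (scale c x) \<subseteq> Poly_Mapping.keys x"
  by (simp add: subset_iff in_keys_iff)

lemma keys_add_subset:
  "\<lbrakk>Poly_Mapping.keys x \<subseteq> B; Poly_Mapping.keys y \<subseteq> B\<rbrakk> \<Longrightarrow> Poly_Mapping.keys (x + y) \<subseteq> B"
  using Poly_Mapping.keys_add[of x y] by blast

lemma keys_scale_subset: "Poly_Mapping.keys x \<subseteq> B \<Longrightarrow> Poly_Mapping.keys (scale c x) \<subseteq> B"
  by (rule order_trans[OF keys_scale])

definition lin_ext :: "('b \<Rightarrow> 'c \<Rightarrow>\<^sub>0 'k) \<Rightarrow> ('b \<Rightarrow>\<^sub>0 'k) \<Rightarrow> ('c \<Rightarrow>\<^sub>0 'k::field)" where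
  "lin_ext g x = (\<Sum>b\<in>Poly_Mapping.keys x. scale (Poly_Mapping.lookup x b) (g b))"

lemma lookup_lin_ext:
  "Poly_Mapping.lookup (lin_ext g x) c =
    (\<Sum>b\<in>Poly_Mapping.keys x. Poly_Mapping.lookup x b * Poly_Mapping.lookup (g b) c)"
  by (simp add: lin_ext_def lookup_sum)

text \<open>The supports of x, y and x + y differ; additivity is proved by writing all three sums
  over one common finite set.\<close>

lemma lookup_lin_ext_superset:
  "\<lbrakk>finite B; Poly_Mapping.keys x \<subseteq> B\<rbrakk> \<Longrightarrow> Poly_Mapping.lookup (lin_ext g x) c =
    (\<Sum>b\<in>B. Poly_Mapping.lookup x b * Poly_Mapping.lookup (g b) c)"
  unfolding lookup_lin_ext
  by (rule sum.mono_neutral_left) (auto simp: not_in_keys_iff_lookup_eq_zero[symmetric])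

lemma lin_ext_add: "lin_ext g (x + y) = lin_ext g x + lin_ext g y"
proof (rule poly_mapping_eqI)
  fix c
  let ?B = "Poly_Mapping.keys x \<union> Poly_Mapping.keys y"
  have B: "finite ?B" "Poly_Mapping.keys (x + y) \<subseteq> ?B" "Poly_Mapping.keys x \<subseteq> ?B" "Poly_Mapping.keys y \<subseteq> ?B"
    using Poly_Mapping.keys_add[of x y] by auto
  show "Poly_Mapping.lookup (lin_ext g (x + y)) c = Poly_Mapping.lookup (lin_ext g x + lin_ext g y) c"
    unfolding lookup_add lookup_lin_ext_superset[OF B(1,2)] lookup_lin_ext_superset[OF B(1,3)]
      lookup_lin_ext_superset[OF B(1,4)]
    by (simp add: distrib_right sum.distrib)
qed

lemma lin_ext_scale: "lin_ext g (scale a x) = scale a (lin_ext g x)"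
proof (rule poly_mapping_eqI)
  fix c
  show "Poly_Mapping.lookup (lin_ext g (scale a x)) c = Poly_Mapping.lookup (scale a (lin_ext g x)) c"
    by (subst lookup_lin_ext_superset[OF finite_keys keys_scale], unfold lookup_scale lookup_lin_ext)
      (simp only: sum_distrib_left mult.assoc)
qed

lemma lin_ext_zero [simp]: "lin_ext g 0 = 0"
  by (simp add: lin_ext_def)

lemma lin_ext_sum: "lin_ext g (sum f A) = (\<Sum>a\<in>A. lin_ext g (f a))"
  by (induction A rule: infinite_finite_induct) (auto simp: lin_ext_add)

lemma lin_ext_diff: "lin_ext g (x - y) = lin_ext g x - lin_ext g y"
  using lin_ext_add[of g "x - y" y] by (simp add: algebra_simps)

lemma lin_ext_single [simp]: "lin_ext g (Poly_Mapping.single b 1) = g b"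
  by (auto simp: lin_ext_def intro!: poly_mapping_eqI)

section \<open>Sums over lists of basis elements and multilinear extensions\<close>

lemma in_listset: "bs \<in> listset As \<longleftrightarrow> list_all2 (\<in>) bs As"
  by (induction As arbitrary: bs) (auto simp: set_Cons_def list_all2_Cons2)

lemma finite_listset: "\<forall>A\<in>set As. finite A \<Longrightarrow> finite (listset As)"
proof (induction As)
  case (Cons A As)
  have "listset (A # As) = (\<lambda>(b, bs). b # bs) ` (A \<times> listset As)"
    by (auto simp: set_Cons_def)
  then show ?case using Cons by simp
qed simp

text \<open>Distributivity for several factors: a list in \<open>listset As\<close> picks one
  summand from each. It factors the coefficients of the image of a composition in
  \<open>tree_words_compo\<close>.\<close>

lemma sum_listset_prod_list:
  assumes "length gs = length As"
  shows "(\<Sum>bs\<in>listset As. prod_list (map2 (\<lambda>g b. g b) gs bs)) =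
    prod_list (map2 (\<lambda>g A. \<Sum>b\<in>A. g b :: 'k :: comm_semiring_1) gs As)"
  using assms
proof (induction gs As rule: list_induct2)
  case (Cons g gs A As)
  have eq: "listset (A # As) = (\<lambda>(b, bs). b # bs) ` (A \<times> listset As)"
    by (auto simp: set_Cons_def)
  have "(\<Sum>bs\<in>listset (A # As). prod_list (map2 (\<lambda>g b. g b) (g # gs) bs)) =
      (\<Sum>(b, bs)\<in>A \<times> listset As. g b * prod_list (map2 (\<lambda>g b. g b) gs bs))"
    unfolding eq by (subst sum.reindex) (auto simp: inj_on_def intro!: sum.cong)
  also have "\<dots> = (\<Sum>b\<in>A. g b) * (\<Sum>bs\<in>listset As. prod_list (map2 (\<lambda>g b. g b) gs bs))"
    by (simp add: sum_product sum.cartesian_product)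
  finally show ?case using Cons.IH by simp
qed simp

text \<open>The indexed product of the definition becomes a \<open>prod_list\<close> over a
  \<open>map2\<close>, a form that can be split along concatenations and list updates.\<close>

lemma lookup_multilinear_ext:
  "Poly_Mapping.lookup (multilinear_ext m x ys) w =
    (\<Sum>b\<in>Poly_Mapping.keys x. \<Sum>bs\<in>listset (map Poly_Mapping.keys ys).
      Poly_Mapping.lookup x b * prod_list (map2 Poly_Mapping.lookup ys bs) *
      Poly_Mapping.lookup (m b bs) w)"
proof -
  have "(\<Prod>i<length ys. Poly_Mapping.lookup (ys ! i) (bs ! i)) =
      prod_list (map2 Poly_Mapping.lookup ys bs)"
    if "bs \<in> listset (map Poly_Mapping.keys ys)" for bs
  proof -
    have "length bs = length ys"
      using that by (auto simp: in_listset dest: list_all2_lengthD)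
    then show ?thesis
      by (simp add: prod.list_conv_set_nth atLeast0LessThan)
  qed
  then show ?thesis
    by (simp add: multilinear_ext_def lookup_sum)
qed

lemma keys_multilinear_ext:
  assumes "\<And>b bs. b \<in> Poly_Mapping.keys x \<Longrightarrow> list_all2 (\<lambda>b y. b \<in> Poly_Mapping.keys y) bs ys \<Longrightarrow>
    Poly_Mapping.keys (m b bs) \<subseteq> B"
  shows "Poly_Mapping.keys (multilinear_ext m x ys) \<subseteq> B"
proof
  fix w assume "w \<in> Poly_Mapping.keys (multilinear_ext m x ys)"
  then have "Poly_Mapping.lookup (multilinear_ext m x ys) w \<noteq> 0"
    by (simp add: in_keys_iff)
  then obtain b where b: "b \<in> Poly_Mapping.keys x" and "(\<Sum>bs\<in>listset (map Poly_Mapping.keys ys).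
      Poly_Mapping.lookup x b * prod_list (map2 Poly_Mapping.lookup ys bs) *
      Poly_Mapping.lookup (m b bs) w) \<noteq> 0"
    unfolding lookup_multilinear_ext by (meson sum.not_neutral_contains_not_neutral)
  then obtain bs where bs: "bs \<in> listset (map Poly_Mapping.keys ys)"
    and "Poly_Mapping.lookup (m b bs) w \<noteq> 0"
    by (metis (no_types, lifting) mult_zero_right sum.not_neutral_contains_not_neutral)
  then show "w \<in> B"
    using assms[of b bs] b by (simp add: in_listset list_all2_map2 in_keys_iff subset_iff)
qed

text \<open>Basis elements in the inner positions leave a map that is linear in the outer argument;
  this is how fixed trees are grafted onto a linear combination.\<close>

lemma multilinear_ext_map_single:
  fixes x :: "'b \<Rightarrow>\<^sub>0 'k::field"
  shows "multilinear_ext m x (map (\<lambda>b. Poly_Mapping.single b 1) bs) = lin_ext (\<lambda>b. m b bs) x"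
proof -
  have "listset (map (Poly_Mapping.keys \<circ> (\<lambda>b. Poly_Mapping.single b (1::'k))) bs) = {bs}"
    by (induction bs) (auto simp: set_Cons_def)
  then show ?thesis
    by (simp add: multilinear_ext_def lin_ext_def)
qed

lemma multilinear_ext_single:
  "multilinear_ext m (Poly_Mapping.single b 1) (map (\<lambda>b. Poly_Mapping.single b 1) bs) = m b bs"
  by (simp only: multilinear_ext_map_single lin_ext_single)

text \<open>The product of the other factors serves as \<open>c\<close>. That one \<open>c\<close>
  works for all y yields linearity of a composition in its i-th inner argument.\<close>

lemma prod_list_map2_update:
  fixes f :: "'a \<Rightarrow> 'b \<Rightarrow> 'k :: comm_monoid_mult"
  assumes "i < length ys" "length ys = length bs"
  obtains c where "\<And>y. prod_list (map2 f (ys[i := y]) bs) = f y (bs ! i) * c"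
proof -
  have "\<exists>c. \<forall>y. prod_list (map2 f (ys[i := y]) bs) = f y (bs ! i) * c"
    using assms
  proof (induction bs arbitrary: ys i)
    case (Cons b bs)
    then obtain z zs where ys: "ys = z # zs" "length zs = length bs"
      by (cases ys) auto
    show ?case
    proof (cases i)
      case 0
      then show ?thesis using ys by auto
    next
      case (Suc j)
      then obtain c where "\<forall>y. prod_list (map2 f (zs[j := y]) bs) = f y (bs ! j) * c"
        using Cons.IH[of j zs] Cons.prems ys by auto
      then show ?thesis using Suc ys
        by (intro exI[of _ "f z b * c"]) (simp add: mult.left_commute)
    qed
  qed simp
  then show ?thesis using that by blast
qed

lemma prod_list_map2_mult:
  fixes xs ys :: "'k :: comm_monoid_mult list"
  assumes "length xs = length ys"
  shows "prod_list (map2 (*) xs ys) = prod_list xs * prod_list ys"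
  using assms by (induction xs ys rule: list_induct2) (simp_all add: ac_simps)

lemma prod_list_map2_concat:
  assumes "list_all2 (\<lambda>xs ys. length xs = length ys) xss yss"
  shows "prod_list (map2 f (concat xss) (concat yss)) =
    prod_list (map2 (\<lambda>xs ys. prod_list (map2 f xs ys)) xss yss)"
  using assms by (induction rule: list_all2_induct) auto

section \<open>Vector spaces with a given basis\<close>

lemma carrier_free_space [simp]: "carrier (free_space B) = {f. Poly_Mapping.keys f \<subseteq> B}"
  and zero_free_space [simp]: "\<zero>\<^bsub>free_space B\<^esub> = 0"
  and add_free_space [simp]: "x \<oplus>\<^bsub>free_space B\<^esub> y = x + y"
  and smult_free_space [simp]: "c \<odot>\<^bsub>free_space B\<^esub> x = scale c x"
  by (simp_all add: free_space_def)

text \<open>The closure facts about sums and multiples are offered as additional premises because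
  \<open>word_operad_eqI\<close> asks that both sides of an equation lie in the component.\<close>

lemma module_hom_free_spaceI:
  assumes "\<And>x. Poly_Mapping.keys x \<subseteq> A \<Longrightarrow> Poly_Mapping.keys (f x) \<subseteq> B"
    and "\<And>x y. \<lbrakk>Poly_Mapping.keys x \<subseteq> A; Poly_Mapping.keys y \<subseteq> A; Poly_Mapping.keys (x + y) \<subseteq> A;
      Poly_Mapping.keys (f x + f y) \<subseteq> B\<rbrakk> \<Longrightarrow> f (x + y) = f x + f y"
    and "\<And>c x. \<lbrakk>Poly_Mapping.keys x \<subseteq> A; Poly_Mapping.keys (scale c x) \<subseteq> A;
      Poly_Mapping.keys (scale c (f x)) \<subseteq> B\<rbrakk> \<Longrightarrow> f (scale c x) = scale c (f x)"
  shows "f \<in> LinearCombinations.module_hom class_ring (free_space A) (free_space B)"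
  unfolding LinearCombinations.module_hom_def by (simp add: Pi_iff assms keys_add_subset keys_scale_subset)

lemma class_ring_field: "field (class_ring :: 'k :: field ring)"
  by (rule class_field.field_axioms)

lemma vectorspace_free_space: "vectorspace class_ring (free_space B :: ('k::field, 'b \<Rightarrow>\<^sub>0 'k) module)"
proof -
  have "abelian_group (free_space B :: ('k, 'b \<Rightarrow>\<^sub>0 'k) module)"
  proof (rule abelian_groupI)
    fix x :: "'b \<Rightarrow>\<^sub>0 'k"
    assume "x \<in> carrier (free_space B)"
    then show "\<exists>y\<in>carrier (free_space B). y \<oplus>\<^bsub>free_space B\<^esub> x = \<zero>\<^bsub>free_space B\<^esub>"
      by (intro bexI[of _ "- x"]) (simp_all add: subset_iff in_keys_iff)
  qed (simp_all add: keys_add_subset ac_simps)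
  moreover have "module_axioms class_ring (free_space B :: ('k, 'b \<Rightarrow>\<^sub>0 'k) module)"
    by (rule module_axioms.intro)
      (simp_all add: keys_scale_subset poly_mapping_eq_iff fun_eq_iff lookup_add algebra_simps)
  ultimately show ?thesis
    by (intro vectorspace.intro Module.module.intro class_ring_field class_cring.cring_axioms)
qed

section \<open>The operad of words\<close>

lemma comps_word_operad [simp]: "comps (word_operad arr) n = free_space {w. length w = n}"
  by (simp add: word_operad_def)

lemma oper_unit_word_operad:
  "oper_unit (word_operad arr) = (\<Sum>\<alpha>\<in>UNIV. Poly_Mapping.single [\<alpha>] 1)"
  by (simp add: word_operad_def)

lemma lookup_unit_word_operad:
  "Poly_Mapping.lookup (oper_unit (word_operad arr)) w = of_bool (length w = 1)"
proof -
  have "Poly_Mapping.lookup (oper_unit (word_operad arr)) w = (\<Sum>\<alpha>\<in>UNIV. of_bool ([\<alpha>] = w))"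
    by (simp add: oper_unit_word_operad lookup_sum lookup_single when_def of_bool_def)
  also have "\<dots> = of_bool (length w = 1)"
    by (cases w; cases "tl w") (auto simp: of_bool_def)
  finally show ?thesis .
qed

lemma keys_unit_word_operad:
  "Poly_Mapping.keys (oper_unit (word_operad arr) :: _ \<Rightarrow>\<^sub>0 'k::field) = {w. length w = 1}"
  by (simp add: set_eq_iff in_keys_iff lookup_unit_word_operad)

lemma compo_word_operad:
  "compo (word_operad arr) ks = multilinear_ext (\<lambda>as bss. Poly_Mapping.single (concat bss)
    (\<Prod>i<length as. of_bool (as ! i = word_value arr (bss ! i))))"
  by (simp add: word_operad_def)

lemma inputs_word_operad:
  "inputs (word_operad arr) ks ys \<longleftrightarrow> list_all2 (\<lambda>k y. Poly_Mapping.keys y \<subseteq> {w. length w = k}) ks ys"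
  by (simp add: inputs_def)

text \<open>Each argument is supported on words of one length, so \<open>W\<close> is the only list
  of words with these lengths whose concatenation is \<open>concat W\<close>. The Kronecker factors
  then leave the word of the block values as the only outer term.\<close>

lemma lookup_compo_word_operad:
  fixes arr :: "'w::finite \<Rightarrow> 'w \<Rightarrow> 'w" and x :: "'w list \<Rightarrow>\<^sub>0 'k::field"
  assumes W: "map length W = ks"
    and x: "x \<in> carrier (comps (word_operad arr) (length ks))" and ys: "inputs (word_operad arr) ks ys"
  shows "Poly_Mapping.lookup (compo (word_operad arr) ks x ys) (concat W) =
    Poly_Mapping.lookup x (map (word_value arr) W) * prod_list (map2 Poly_Mapping.lookup ys W)"
proof -
  let ?v = "map (word_value arr) W" and ?p = "\<lambda>bs. prod_list (map2 Poly_Mapping.lookup ys bs)"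
  let ?B = "listset (map Poly_Mapping.keys ys)"
  have len: "length ys = length W"
    using ys W by (auto simp: inputs_def dest: list_all2_lengthD)
  have "Poly_Mapping.lookup x b * ?p bs * Poly_Mapping.lookup (Poly_Mapping.single (concat bs)
        (\<Prod>i<length b. of_bool (b ! i = word_value arr (bs ! i)))) (concat W) =
      (if b = ?v then Poly_Mapping.lookup x b else 0) * (if bs = W then ?p bs else 0)"
    if b: "b \<in> Poly_Mapping.keys x" and bs: "bs \<in> ?B" for b bs
  proof -
    have "list_all2 (\<lambda>b k. length b = k) bs ks"
      using bs ys by (force simp: in_listset inputs_word_operad list_all2_conv_all_nth)
    then have "list_all2 (\<lambda>b w. length b = length w) bs W"
      using W by (auto simp: list_all2_map2)
    then have "concat bs = concat W \<longleftrightarrow> bs = W"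
      using concat_injective[of bs W] by (auto simp: list_all2_iff)
    moreover have "(\<Prod>i<length b. of_bool (b ! i = word_value arr (W ! i))) =
        (of_bool (b = ?v) :: 'k)"
    proof -
      have "length b = length W"
        using x W b by auto
      then have "b = ?v \<longleftrightarrow> (\<forall>i<length b. b ! i = word_value arr (W ! i))"
        by (auto simp: list_eq_iff_nth_eq)
      then show ?thesis
        by (cases "b = ?v") auto
    qed
    ultimately show ?thesis
      by (simp add: lookup_single when_def)
  qed
  then have "Poly_Mapping.lookup (compo (word_operad arr) ks x ys) (concat W) =
      (\<Sum>b\<in>Poly_Mapping.keys x. \<Sum>bs\<in>?B.
        (if b = ?v then Poly_Mapping.lookup x b else 0) * (if bs = W then ?p bs else 0))"
    unfolding compo_word_operad lookup_multilinear_ext by (intro sum.cong refl) blast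
  also have "\<dots> = (\<Sum>b\<in>Poly_Mapping.keys x. if b = ?v then Poly_Mapping.lookup x b else 0) *
      (\<Sum>bs\<in>?B. if bs = W then ?p bs else 0)"
    by (rule sum_product[symmetric])
  also have "(\<Sum>b\<in>Poly_Mapping.keys x. if b = ?v then Poly_Mapping.lookup x b else 0) =
      Poly_Mapping.lookup x ?v"
    by (simp add: not_in_keys_iff_lookup_eq_zero)
  \<comment> \<open>If some block of \<open>W\<close> lies outside the support of its argument, the
    sum has no nonzero term and the product on the right has a zero factor.\<close>
  also have "(\<Sum>bs\<in>?B. if bs = W then ?p bs else 0) = ?p W"
  proof (cases "W \<in> ?B")
    case True
    then show ?thesis by (simp add: finite_listset)
  next
    case False
    with len have "\<exists>i<length W. W ! i \<notin> Poly_Mapping.keys (ys ! i)"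
      by (simp add: in_listset list_all2_conv_all_nth)
    then obtain i where "i < length W" "Poly_Mapping.lookup (ys ! i) (W ! i) = 0"
      unfolding not_in_keys_iff_lookup_eq_zero by blast
    then have "0 \<in> set (map2 Poly_Mapping.lookup ys W)"
      using len unfolding in_set_conv_nth by (intro exI[of _ i]) simp
    then have "?p W = 0"
      by (simp only: prod_list_zero_iff)
    moreover have "(\<Sum>bs\<in>?B. if bs = W then ?p bs else 0) = 0"
      by (rule sum.neutral) (use False in metis)
    ultimately show ?thesis by (simp only:)
  qed
  finally show ?thesis .
qed

lemma compo_word_operad_closed:
  assumes "x \<in> carrier (comps (word_operad arr) (length ks))" "inputs (word_operad arr) ks ys"
  shows "compo (word_operad arr) ks x ys \<in> carrier (comps (word_operad arr) (sum_list ks))"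
proof -
  have "length (concat bs) = sum_list ks"
    if "list_all2 (\<lambda>b y. b \<in> Poly_Mapping.keys y) bs ys" for bs
  proof -
    have "list_all2 (\<lambda>b k. length b = k) bs ks"
      using that assms(2) by (fastforce simp: inputs_word_operad list_all2_conv_all_nth)
    then have "map length bs = ks"
      by (induction rule: list_all2_induct) auto
    then show ?thesis
      by (simp add: length_concat)
  qed
  then show ?thesis
    unfolding compo_word_operad comps_word_operad carrier_free_space mem_Collect_eq
    by (intro keys_multilinear_ext) (auto split: if_splits)
qed

lemma split_word:
  assumes "length w = sum_list ks"
  obtains W where "map length W = ks" "concat W = w"
proof -
  have "\<exists>W. map length W = ks \<and> concat W = w"
    using assms
  proof (induction ks arbitrary: w)
    case (Cons k ks)
    then obtain W where "map length W = ks" "concat W = drop k w"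
      by (metis add_diff_cancel_left' length_drop sum_list.Cons)
    then show ?case using Cons.prems
      by (intro exI[of _ "take k w # W"]) auto
  qed simp
  then show ?thesis using that by blast
qed

text \<open>By \<open>split_word\<close> every word of length \<open>sum_list ks\<close> can be cut
  into blocks of lengths \<open>ks\<close>, so the coefficient formula for compositions reaches all
  words.\<close>

lemma word_operad_eqI:
  assumes "x \<in> carrier (comps (word_operad arr) (sum_list ks))"
    and "y \<in> carrier (comps (word_operad arr) (sum_list ks))"
    and "\<And>W. map length W = ks \<Longrightarrow> Poly_Mapping.lookup x (concat W) = Poly_Mapping.lookup y (concat W)"
  shows "x = y"
proof (rule poly_mapping_eqI)
  fix w
  show "Poly_Mapping.lookup x w = Poly_Mapping.lookup y w"
  proof (cases "length w = sum_list ks")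
    case True
    then obtain W where "map length W = ks" "concat W = w"
      by (rule split_word)
    then show ?thesis using assms(3) by blast
  next
    case False
    then have "w \<notin> Poly_Mapping.keys x" "w \<notin> Poly_Mapping.keys y"
      using assms(1,2) by auto
    then show ?thesis by (simp add: in_keys_iff)
  qed
qed

section \<open>Values of words in a semigroup\<close>

lemma word_value_single [simp]: "word_value arr [\<alpha>] = \<alpha>"
  by (simp add: word_value_def)

context
  fixes arr :: "'w \<Rightarrow> 'w \<Rightarrow> 'w"
  assumes semigroup: "semigroup arr"
begin

lemma foldl_arr: "foldl arr (arr \<alpha> \<beta>) bs = arr \<alpha> (foldl arr \<beta> bs)"
  using semigroup.assoc[OF semigroup] by (induction bs arbitrary: \<beta>) auto

text \<open>The definition folds from the left; associativity allows the first letter to be split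
  off instead, which is the recursion of right combs.\<close>

lemma word_value_Cons: "bs \<noteq> [] \<Longrightarrow> word_value arr (\<alpha> # bs) = arr \<alpha> (word_value arr bs)"
  by (cases bs) (auto simp: word_value_def foldl_arr)

lemma word_value_append:
  "\<lbrakk>as \<noteq> []; bs \<noteq> []\<rbrakk> \<Longrightarrow> word_value arr (as @ bs) = arr (word_value arr as) (word_value arr bs)"
proof (induction as)
  case (Cons \<alpha> as)
  then show ?case
    using semigroup.assoc[OF semigroup] by (cases "as = []") (auto simp: word_value_Cons)
qed simp

text \<open>The source of associativity in P: nested compositions impose the same conditions on
  letters whether a group of blocks is evaluated as one word or through its block values. Blocks are
  nonempty because the value of the empty word is unspecified.\<close>

lemma word_value_concat:
  "\<lbrakk>W \<noteq> []; [] \<notin> set W\<rbrakk> \<Longrightarrow> word_value arr (concat W) = word_value arr (map (word_value arr) W)"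
proof (induction W)
  case (Cons w W)
  then show ?case
    by (cases W) (auto simp: word_value_Cons word_value_append)
qed simp

end

context
  fixes arr :: "'w::finite \<Rightarrow> 'w \<Rightarrow> 'w"
  assumes semigroup: "semigroup arr"
begin

text \<open>At every word both sides have the same coefficient: that of x at the values of the
  groups of blocks, times those of the \<open>ys\<close> at the words of block values, times those
  of the \<open>zss\<close> at the blocks.\<close>

lemma compo_word_operad_assoc:
  fixes x :: "'w list \<Rightarrow>\<^sub>0 'k::field"
  defines "P \<equiv> word_operad arr :: ('k, 'w list \<Rightarrow>\<^sub>0 'k) nsop"
  assumes "kss \<noteq> []" and valid: "\<forall>ks\<in>set kss. valid_arities ks"
    and x: "x \<in> carrier (comps P (length kss))" and ys: "inputs P (map length kss) ys"
    and zss: "list_all2 (inputs P) kss zss"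
  shows "compo P (concat kss) (compo P (map length kss) x ys) (concat zss) =
    compo P (map sum_list kss) x (map2 (\<lambda>ks (y, zs). compo P ks y zs) kss (zip ys zss))"
proof (rule word_operad_eqI[of _ arr "concat kss"])
  have len: "length ys = length kss" "length zss = length kss"
    using ys zss by (auto simp: inputs_def dest: list_all2_lengthD)
  have y: "ys ! i \<in> carrier (comps P (length (kss ! i)))" and z: "inputs P (kss ! i) (zss ! i)"
    if "i < length kss" for i
    using ys zss that by (auto simp: inputs_def list_all2_conv_all_nth)
  have cz: "inputs P (concat kss) (concat zss)"
    using zss unfolding inputs_def
    by (induction rule: list_all2_induct) (auto intro: list_all2_appendI)
  have xy: "compo P (map length kss) x ys \<in> carrier (comps P (length (concat kss)))"
    using compo_word_operad_closed[of x arr "map length kss" ys] x ys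
    by (simp add: P_def length_concat)
  have yz: "inputs P (map sum_list kss) (map2 (\<lambda>ks (y, zs). compo P ks y zs) kss (zip ys zss))"
    unfolding inputs_def
  proof (rule list_all2_all_nthI)
    fix i assume "i < length (map sum_list kss)"
    then show "map2 (\<lambda>ks (y, zs). compo P ks y zs) kss (zip ys zss) ! i
        \<in> carrier (comps P (map sum_list kss ! i))"
      using y[of i] z[of i] compo_word_operad_closed[of "ys ! i" arr "kss ! i" "zss ! i"] len
      by (simp add: P_def)
  qed (use len in simp)
  show "compo P (concat kss) (compo P (map length kss) x ys) (concat zss)
      \<in> carrier (comps (word_operad arr) (sum_list (concat kss)))"
    using compo_word_operad_closed[of _ arr "concat kss"] xy cz by (simp add: P_def)
  have "sum_list (map sum_list kss) = sum_list (concat kss)"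
    by (induction kss) auto
  then show "compo P (map sum_list kss) x (map2 (\<lambda>ks (y, zs). compo P ks y zs) kss (zip ys zss))
      \<in> carrier (comps (word_operad arr) (sum_list (concat kss)))"
    using compo_word_operad_closed[of x arr "map sum_list kss"] x yz by (simp add: P_def)
  fix W :: "'w list list"
  assume W: "map length W = concat kss"
  then have "length W = sum_list (map length kss)"
    by (metis length_concat length_map)
  \<comment> \<open>\<open>V\<close> groups the blocks of \<open>W\<close> as \<open>kss\<close>
    groups the arities: \<open>V ! i\<close> collects the blocks for the arguments of
    \<open>ys ! i\<close>.\<close>
  then obtain V where V: "map length V = map length kss" "concat V = W"
    by (rule split_word)
  then have lenV: "length V = length kss"
    by (metis length_map)
  have shape: "map length (V ! i) = kss ! i" if "i < length kss" for i
  proof -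
    have "concat (map (map length) V) = concat kss"
      using W V(2) by (metis map_concat)
    moreover have "\<forall>(a, b)\<in>set (zip (map (map length) V) kss). length a = length b"
      using V(1) lenV by (auto simp: set_zip list_eq_iff_nth_eq)
    ultimately have "map (map length) V = kss"
      using lenV by (intro concat_injective) auto
    then show ?thesis using that lenV by (metis nth_map)
  qed
  have len_V: "length (V ! i) = length (kss ! i)" if "i < length kss" for i
    using shape[OF that] by (metis length_map)
  have W': "concat W = concat (map concat V)"
    unfolding V(2)[symmetric] by (induction V) auto
  \<comment> \<open>The right side of associativity evaluates a group as one concatenated word, the
    left side as the word of its block values.\<close>
  have val: "map (word_value arr) (map concat V) = map (word_value arr) (map (map (word_value arr)) V)"
  proof (rule nth_equalityI)
    fix i assume "i < length (map (word_value arr) (map concat V))"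
    then have i: "i < length kss" using lenV by simp
    then have "valid_arities (map length (V ! i))"
      using valid shape by simp
    then show "map (word_value arr) (map concat V) ! i =
        map (word_value arr) (map (map (word_value arr)) V) ! i"
      using i lenV by (auto simp: valid_arities_def intro!: word_value_concat[OF semigroup])
  qed simp
  have p1: "prod_list (map2 Poly_Mapping.lookup (map2 (\<lambda>ks (y, zs). compo P ks y zs) kss (zip ys zss))
        (map concat V)) =
      prod_list (map2 Poly_Mapping.lookup ys (map (map (word_value arr)) V)) *
      prod_list (map2 (\<lambda>zs ws. prod_list (map2 Poly_Mapping.lookup zs ws)) zss V)"
  proof -
    have "Poly_Mapping.lookup (compo P (kss ! i) (ys ! i) (zss ! i)) (concat (V ! i)) =
        Poly_Mapping.lookup (ys ! i) (map (word_value arr) (V ! i)) *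
        prod_list (map2 Poly_Mapping.lookup (zss ! i) (V ! i))" if "i < length kss" for i
      using lookup_compo_word_operad[OF shape[OF that], of "ys ! i" arr "zss ! i"] y[OF that] z[OF that]
      by (simp add: P_def)
    then have "map2 Poly_Mapping.lookup (map2 (\<lambda>ks (y, zs). compo P ks y zs) kss (zip ys zss)) (map concat V) =
        map2 (*) (map2 Poly_Mapping.lookup ys (map (map (word_value arr)) V))
          (map2 (\<lambda>zs ws. prod_list (map2 Poly_Mapping.lookup zs ws)) zss V)"
      using len lenV by (intro nth_equalityI) simp_all
    then show ?thesis
      using len lenV by (simp only:) (rule prod_list_map2_mult, simp)
  qed
  have p2: "prod_list (map2 (\<lambda>zs ws. prod_list (map2 Poly_Mapping.lookup zs ws)) zss V) =
      prod_list (map2 Poly_Mapping.lookup (concat zss) W)"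
    unfolding V(2)[symmetric]
    using len lenV len_V z
    by (intro prod_list_map2_concat[symmetric])
      (auto simp: list_all2_conv_all_nth inputs_def)
  have L: "Poly_Mapping.lookup (compo P (map length kss) x ys) (map (word_value arr) W) =
      Poly_Mapping.lookup x (map (word_value arr) (map (map (word_value arr)) V)) *
      prod_list (map2 Poly_Mapping.lookup ys (map (map (word_value arr)) V))"
    unfolding V(2)[symmetric] map_concat
    using V(1) x ys by (subst P_def, subst lookup_compo_word_operad) (simp_all add: P_def comp_def)
  have R: "Poly_Mapping.lookup (compo P (map sum_list kss) x (map2 (\<lambda>ks (y, zs). compo P ks y zs) kss (zip ys zss)))
        (concat (map concat V)) =
      Poly_Mapping.lookup x (map (word_value arr) (map concat V)) *
      prod_list (map2 Poly_Mapping.lookup (map2 (\<lambda>ks (y, zs). compo P ks y zs) kss (zip ys zss)) (map concat V))"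
  proof -
    have "map length (map concat V) = map sum_list kss"
      using shape lenV by (intro nth_equalityI) (auto simp: length_concat)
    then show ?thesis
      using lookup_compo_word_operad[of "map concat V" "map sum_list kss" x arr] x yz
      by (simp add: P_def)
  qed
  have LL: "Poly_Mapping.lookup (compo P (concat kss) (compo P (map length kss) x ys) (concat zss)) (concat W) =
      Poly_Mapping.lookup (compo P (map length kss) x ys) (map (word_value arr) W) *
      prod_list (map2 Poly_Mapping.lookup (concat zss) W)"
    using lookup_compo_word_operad[OF W, of "compo P (map length kss) x ys" arr "concat zss"] xy cz
    by (simp add: P_def)
  show "Poly_Mapping.lookup (compo P (concat kss) (compo P (map length kss) x ys) (concat zss)) (concat W) =
      Poly_Mapping.lookup (compo P (map sum_list kss) x (map2 (\<lambda>ks (y, zs). compo P ks y zs) kss (zip ys zss))) (concat W)"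
    unfolding LL L p2[symmetric] unfolding W' R val p1 by (rule mult.assoc)
qed

lemma ns_operad_word_operad: "ns_operad (word_operad arr :: ('k::field, 'w list \<Rightarrow>\<^sub>0 'k) nsop)"
  (is "ns_operad ?P")
proof (rule ns_operad.intro)
  show "vectorspace class_ring (comps ?P n)" for n
    by (simp add: vectorspace_free_space)
  show "oper_unit ?P \<in> carrier (comps ?P 1)"
    by (simp add: keys_unit_word_operad)
next
  fix ks and ys :: "('w list \<Rightarrow>\<^sub>0 'k) list"
  assume ys: "inputs ?P ks ys"
  have closed: "Poly_Mapping.keys (compo ?P ks x ys) \<subseteq> {w. length w = sum_list ks}"
    if "Poly_Mapping.keys x \<subseteq> {w. length w = length ks}" for x
    using compo_word_operad_closed[of x arr ks ys] that ys by simp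
  show "(\<lambda>x. compo ?P ks x ys) \<in> LinearCombinations.module_hom class_ring
      (comps ?P (length ks)) (comps ?P (sum_list ks))"
    unfolding comps_word_operad
  proof (rule module_hom_free_spaceI)
    fix x z :: "'w list \<Rightarrow>\<^sub>0 'k"
    assume "Poly_Mapping.keys x \<subseteq> {w. length w = length ks}" "Poly_Mapping.keys z \<subseteq> {w. length w = length ks}"
      "Poly_Mapping.keys (x + z) \<subseteq> {w. length w = length ks}"
      "Poly_Mapping.keys (compo ?P ks x ys + compo ?P ks z ys) \<subseteq> {w. length w = sum_list ks}"
    then show "compo ?P ks (x + z) ys = compo ?P ks x ys + compo ?P ks z ys"
      using closed ys
      by (intro word_operad_eqI[of _ arr ks]) (simp_all add: lookup_compo_word_operad lookup_add distrib_right)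
  next
    fix c and x :: "'w list \<Rightarrow>\<^sub>0 'k"
    assume "Poly_Mapping.keys x \<subseteq> {w. length w = length ks}"
      "Poly_Mapping.keys (scale c x) \<subseteq> {w. length w = length ks}"
      "Poly_Mapping.keys (scale c (compo ?P ks x ys)) \<subseteq> {w. length w = sum_list ks}"
    then show "compo ?P ks (scale c x) ys = scale c (compo ?P ks x ys)"
      using closed ys
      by (intro word_operad_eqI[of _ arr ks]) (simp_all add: lookup_compo_word_operad mult.assoc)
  qed (use closed in auto)
next
  fix ks i x and ys :: "('w list \<Rightarrow>\<^sub>0 'k) list"
  assume x: "x \<in> carrier (comps ?P (length ks))" and ys: "inputs ?P ks ys" and i: "i < length ks"
  have len: "length ys = length ks"
    using ys by (auto simp: inputs_def dest: list_all2_lengthD)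
  have ys': "inputs ?P ks (ys[i := y])" if "Poly_Mapping.keys y \<subseteq> {w. length w = ks ! i}" for y
    using ys that i by (auto simp: inputs_word_operad list_all2_conv_all_nth nth_list_update)
  have closed: "Poly_Mapping.keys (compo ?P ks x (ys[i := y])) \<subseteq> {w. length w = sum_list ks}"
    if "Poly_Mapping.keys y \<subseteq> {w. length w = ks ! i}" for y
    using compo_word_operad_closed[of x arr ks "ys[i := y]"] that ys' x by simp
  \<comment> \<open>The factor \<open>c\<close> depends on \<open>W\<close> but not on y, which
    gives additivity and homogeneity together.\<close>
  have lookup: "\<exists>c. \<forall>y. Poly_Mapping.keys y \<subseteq> {w. length w = ks ! i} \<longrightarrow>
      Poly_Mapping.lookup (compo ?P ks x (ys[i := y])) (concat W) = c * Poly_Mapping.lookup y (W ! i)"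
    if W: "map length W = ks" for W
  proof -
    have "length ys = length W" using W len by auto
    with i len obtain c where "\<And>y. prod_list (map2 Poly_Mapping.lookup (ys[i := y]) W) =
        Poly_Mapping.lookup y (W ! i) * c"
      by (metis prod_list_map2_update)
    then show ?thesis
      using W x ys'
      by (intro exI[of _ "Poly_Mapping.lookup x (map (word_value arr) W) * c"])
        (simp add: lookup_compo_word_operad del: comps_word_operad)
  qed
  show "(\<lambda>y. compo ?P ks x (ys[i := y])) \<in> LinearCombinations.module_hom class_ring
      (comps ?P (ks ! i)) (comps ?P (sum_list ks))"
    unfolding comps_word_operad
  proof (rule module_hom_free_spaceI)
    show "compo ?P ks x (ys[i := y + z]) = compo ?P ks x (ys[i := y]) + compo ?P ks x (ys[i := z])"
      if "Poly_Mapping.keys y \<subseteq> {w. length w = ks ! i}" "Poly_Mapping.keys z \<subseteq> {w. length w = ks ! i}"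
        "Poly_Mapping.keys (y + z) \<subseteq> {w. length w = ks ! i}"
        "Poly_Mapping.keys (compo ?P ks x (ys[i := y]) + compo ?P ks x (ys[i := z]))
          \<subseteq> {w. length w = sum_list ks}" for y z
    proof (rule word_operad_eqI[of _ arr ks])
      fix W :: "'w list list" assume "map length W = ks"
      from lookup[OF this] that
      show "Poly_Mapping.lookup (compo ?P ks x (ys[i := y + z])) (concat W) =
          Poly_Mapping.lookup (compo ?P ks x (ys[i := y]) + compo ?P ks x (ys[i := z])) (concat W)"
        by (auto simp: lookup_add distrib_left)
    qed (use that closed in auto)
    show "compo ?P ks x (ys[i := scale c y]) = scale c (compo ?P ks x (ys[i := y]))"
      if "Poly_Mapping.keys y \<subseteq> {w. length w = ks ! i}"
        "Poly_Mapping.keys (scale c y) \<subseteq> {w. length w = ks ! i}"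
        "Poly_Mapping.keys (scale c (compo ?P ks x (ys[i := y]))) \<subseteq> {w. length w = sum_list ks}" for c y
    proof (rule word_operad_eqI[of _ arr ks])
      fix W :: "'w list list" assume "map length W = ks"
      from lookup[OF this] that
      show "Poly_Mapping.lookup (compo ?P ks x (ys[i := scale c y])) (concat W) =
          Poly_Mapping.lookup (scale c (compo ?P ks x (ys[i := y]))) (concat W)"
        by auto
    qed (use that closed in auto)
  qed (use closed in auto)
next
  fix k and y :: "'w list \<Rightarrow>\<^sub>0 'k"
  assume "y \<in> carrier (comps ?P k)"
  then have y: "inputs ?P [k] [y]" by (simp add: inputs_def)
  have I: "oper_unit ?P \<in> carrier (comps ?P (length [k]))"
    by (simp add: keys_unit_word_operad)
  show "compo ?P [k] (oper_unit ?P) [y] = y"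
  proof (rule word_operad_eqI[of _ arr "[k]"])
    fix W :: "'w list list" assume "map length W = [k]"
    with lookup_compo_word_operad[OF this I y]
    show "Poly_Mapping.lookup (compo ?P [k] (oper_unit ?P) [y]) (concat W) =
        Poly_Mapping.lookup y (concat W)"
      by (auto simp: lookup_unit_word_operad)
  qed (use compo_word_operad_closed[OF I y] y in \<open>simp_all add: inputs_def\<close>)
next
  fix n and x :: "'w list \<Rightarrow>\<^sub>0 'k"
  assume x: "x \<in> carrier (comps ?P n)"
  let ?ks = "replicate n 1" and ?ys = "replicate n (oper_unit ?P)"
  have x': "x \<in> carrier (comps ?P (length ?ks))" using x by simp
  have ys: "inputs ?P ?ks ?ys"
    by (simp add: inputs_word_operad list_all2_conv_all_nth keys_unit_word_operad)
  show "compo ?P ?ks x ?ys = x"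
  proof (rule word_operad_eqI[of _ arr ?ks])
    fix W :: "'w list list" assume W: "map length W = ?ks"
    then have "\<forall>w\<in>set W. length w = 1"
      by (metis in_set_replicate list.set_map imageI)
    then have "map (word_value arr) W = concat W"
      "prod_list (map2 Poly_Mapping.lookup (replicate (length W) (oper_unit ?P)) W) = 1"
      by (induction W) (auto simp: length_Suc_conv lookup_unit_word_operad)
    moreover have "length W = n" using W by (metis length_map length_replicate)
    ultimately show "Poly_Mapping.lookup (compo ?P ?ks x ?ys) (concat W) = Poly_Mapping.lookup x (concat W)"
      using lookup_compo_word_operad[OF W x' ys] by simp
  qed (use compo_word_operad_closed[OF x' ys] x in \<open>simp_all add: sum_list_replicate\<close>)
qed (rule compo_word_operad_assoc)

end

section \<open>Transport of structure\<close>

lemma module_hom_restrict: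
  assumes "f \<in> LinearCombinations.module_hom R M N" "S \<subseteq> carrier M" "\<And>x. x \<in> S \<Longrightarrow> f x \<in> T"
  shows "f \<in> LinearCombinations.module_hom R (M\<lparr>carrier := S\<rparr>) (N\<lparr>carrier := T\<rparr>)"
  using assms unfolding LinearCombinations.module_hom_def by (auto simp: subset_iff)

lemma (in ns_operad) compo_closed:
  assumes "valid_arities ks" "x \<in> carrier (comps P (length ks))" "inputs P ks ys"
  shows "compo P ks x ys \<in> carrier (comps P (sum_list ks))"
  using linear_outer[OF assms(1,3)] assms(2) by (auto simp: LinearCombinations.module_hom_def)

section \<open>Arities and inputs of compositions\<close>

lemma valid_arities_length: "valid_arities ks \<Longrightarrow> 1 \<le> length ks"
  by (cases ks) (auto simp: valid_arities_def)

lemma valid_arities_sum_list: "valid_arities ks \<Longrightarrow> 1 \<le> sum_list ks"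
  by (cases ks) (auto simp: valid_arities_def)

lemma valid_arities_nth: "\<lbrakk>valid_arities ks; i < length ks\<rbrakk> \<Longrightarrow> 1 \<le> ks ! i"
  by (auto simp: valid_arities_def)

lemma valid_arities_concat:
  "\<lbrakk>kss \<noteq> []; \<forall>ks\<in>set kss. valid_arities ks\<rbrakk> \<Longrightarrow> valid_arities (concat kss)"
  by (cases kss) (auto simp: valid_arities_def)

lemma valid_arities_map_length:
  "\<lbrakk>kss \<noteq> []; \<forall>ks\<in>set kss. valid_arities ks\<rbrakk> \<Longrightarrow> valid_arities (map length kss)"
  using valid_arities_length by (auto simp: valid_arities_def[of "map length kss"])

lemma valid_arities_map_sum_list:
  "\<lbrakk>kss \<noteq> []; \<forall>ks\<in>set kss. valid_arities ks\<rbrakk> \<Longrightarrow> valid_arities (map sum_list kss)"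
  using valid_arities_sum_list by (auto simp: valid_arities_def[of "map sum_list kss"])

lemma inputs_nth: "\<lbrakk>inputs P ks ys; i < length ks\<rbrakk> \<Longrightarrow> ys ! i \<in> carrier (comps P (ks ! i))"
  by (auto simp: inputs_def list_all2_conv_all_nth)

lemma inputs_length: "inputs P ks ys \<Longrightarrow> length ys = length ks"
  by (auto simp: inputs_def dest: list_all2_lengthD)

lemma inputs_concat: "list_all2 (inputs P) kss zss \<Longrightarrow> inputs P (concat kss) (concat zss)"
  unfolding inputs_def by (induction rule: list_all2_induct) (auto intro: list_all2_appendI)

lemma inputs_update:
  "\<lbrakk>inputs P ks ys; i < length ks; y \<in> carrier (comps P (ks ! i))\<rbrakk> \<Longrightarrow> inputs P ks (ys[i := y])"
  by (auto simp: inputs_def list_all2_conv_all_nth nth_list_update)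

lemma (in ns_operad) inputs_compo:
  assumes "\<forall>ks\<in>set kss. valid_arities ks" "inputs P (map length kss) ys" "list_all2 (inputs P) kss zss"
  shows "inputs P (map sum_list kss) (map2 (\<lambda>ks (y, zs). compo P ks y zs) kss (zip ys zss))"
  unfolding inputs_def
proof (rule list_all2_all_nthI)
  have len: "length ys = length kss" "length zss = length kss"
    using assms by (auto dest: inputs_length list_all2_lengthD)
  then show "length (map sum_list kss) = length (map2 (\<lambda>ks (y, zs). compo P ks y zs) kss (zip ys zss))"
    by simp
  fix i assume "i < length (map sum_list kss)"
  then have i: "i < length kss" by simp
  then have "compo P (kss ! i) (ys ! i) (zss ! i) \<in> carrier (comps P (sum_list (kss ! i)))"
    using assms inputs_nth[OF assms(2), of i] by (intro compo_closed) (auto simp: list_all2_conv_all_nth)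
  then show "map2 (\<lambda>ks (y, zs). compo P ks y zs) kss (zip ys zss) ! i
      \<in> carrier (comps P (map sum_list kss ! i))"
    using i len by simp
qed

section \<open>Suboperads as operads\<close>

lemma comps_restrict_operad [simp]: "comps (restrict_operad P S) n = comps P n\<lparr>carrier := S n\<rparr>"
  and compo_restrict_operad [simp]: "compo (restrict_operad P S) = compo P"
  and oper_unit_restrict_operad [simp]: "oper_unit (restrict_operad P S) = oper_unit P"
  by (simp_all add: restrict_operad_def)

lemma ns_operad_restrict_operad:
  assumes "ns_operad P" and sub: "suboperad P S"
  shows "ns_operad (restrict_operad P S)"
proof -
  interpret ns_operad P by fact
  have subspace: "VectorSpace.subspace class_ring (S n) (comps P n)" if "1 \<le> n" for n
    using sub that by (auto simp: suboperad_def)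
  have S: "S n \<subseteq> carrier (comps P n)" if "1 \<le> n" for n
    using subspace[OF that] by (simp add: VectorSpace.subspace_def submodule_def)
  have inputs: "inputs P ks ys" if "valid_arities ks" "inputs (restrict_operad P S) ks ys" for ks ys
    using that(2) S[OF valid_arities_nth[OF that(1)]]
    by (auto simp: inputs_def list_all2_conv_all_nth subset_iff)
  have closed: "compo P ks x ys \<in> S (sum_list ks)"
    if "valid_arities ks" "x \<in> S (length ks)" "inputs (restrict_operad P S) ks ys" for ks x ys
    using sub that by (auto simp: suboperad_def inputs_def)
  show ?thesis
  proof (rule ns_operad.intro)
    show "vectorspace class_ring (comps (restrict_operad P S) n)" if "1 \<le> n" for n
      using vectorspace.subspace_is_vs[OF vectorspace_comps subspace] that by simp
    show "oper_unit (restrict_operad P S) \<in> carrier (comps (restrict_operad P S) 1)"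
      using sub by (simp add: suboperad_def)
  next
    fix ks ys assume ks: "valid_arities ks" "inputs (restrict_operad P S) ks ys"
    show "(\<lambda>x. compo (restrict_operad P S) ks x ys) \<in> LinearCombinations.module_hom class_ring
        (comps (restrict_operad P S) (length ks)) (comps (restrict_operad P S) (sum_list ks))"
      unfolding comps_restrict_operad compo_restrict_operad
      using ks by (intro module_hom_restrict linear_outer inputs closed S valid_arities_length)
  next
    fix ks x ys i
    assume *: "valid_arities ks" "x \<in> carrier (comps (restrict_operad P S) (length ks))"
      "inputs (restrict_operad P S) ks ys" "i < length ks"
    then have x: "x \<in> S (length ks)" "x \<in> carrier (comps P (length ks))"
      using S valid_arities_length by auto
    have "compo P ks x (ys[i := y]) \<in> S (sum_list ks)" if "y \<in> S (ks ! i)" for y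
      using * x that by (intro closed inputs_update) auto
    then show "(\<lambda>y. compo (restrict_operad P S) ks x (ys[i := y])) \<in> LinearCombinations.module_hom class_ring
        (comps (restrict_operad P S) (ks ! i)) (comps (restrict_operad P S) (sum_list ks))"
      unfolding comps_restrict_operad compo_restrict_operad
      using * x by (intro module_hom_restrict linear_inner inputs S valid_arities_nth)
  next
    show "compo (restrict_operad P S) [k] (oper_unit (restrict_operad P S)) [y] = y"
      if "1 \<le> k" "y \<in> carrier (comps (restrict_operad P S) k)" for k y
      using that S[of k] unit_left[of k y] by auto
    show "compo (restrict_operad P S) (replicate n 1) x (replicate n (oper_unit (restrict_operad P S))) = x"
      if "1 \<le> n" "x \<in> carrier (comps (restrict_operad P S) n)" for n x
      using that S[of n] unit_right[of n x] by auto
  next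
    fix kss x ys zss
    assume *: "kss \<noteq> []" "\<forall>ks\<in>set kss. valid_arities ks"
      "x \<in> carrier (comps (restrict_operad P S) (length kss))"
      "inputs (restrict_operad P S) (map length kss) ys"
      "list_all2 (inputs (restrict_operad P S)) kss zss"
    have "x \<in> carrier (comps P (length kss))"
      using *(1,3) S[of "length kss"] by (cases kss) auto
    moreover have "inputs P (map length kss) ys"
      using * inputs valid_arities_map_length by blast
    moreover have "list_all2 (inputs P) kss zss"
      using * inputs by (auto simp: list_all2_conv_all_nth)
    ultimately show "compo (restrict_operad P S) (concat kss)
        (compo (restrict_operad P S) (map length kss) x ys) (concat zss) =
      compo (restrict_operad P S) (map sum_list kss) x
        (map2 (\<lambda>ks (y, zs). compo (restrict_operad P S) ks y zs) kss (zip ys zss))"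
      using assoc *(1,2) by simp
  qed
qed

text \<open>W is not assumed to be a vector space; its laws are those of V read through
  \<open>\<phi>\<close>. The zero is a premise of its own because preserving sums and multiples says
  nothing about the zero field of a bare record.\<close>

lemma vectorspace_transport:
  assumes "vectorspace K V" and bij: "bij_betw \<phi> (carrier V) (carrier W)"
    and hom: "\<phi> \<in> LinearCombinations.module_hom K V W" and zero: "\<phi> \<zero>\<^bsub>V\<^esub> = \<zero>\<^bsub>W\<^esub>"
  shows "vectorspace K W"
proof -
  interpret V: vectorspace K V by fact
  have W: "carrier W = \<phi> ` carrier V"
    using bij by (simp add: bij_betw_def)
  have add: "\<phi> x \<oplus>\<^bsub>W\<^esub> \<phi> y = \<phi> (x \<oplus>\<^bsub>V\<^esub> y)" if "x \<in> carrier V" "y \<in> carrier V" for x y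
    using hom that by (simp add: LinearCombinations.module_hom_def)
  have smult: "c \<odot>\<^bsub>W\<^esub> \<phi> x = \<phi> (c \<odot>\<^bsub>V\<^esub> x)" if "c \<in> carrier K" "x \<in> carrier V" for c x
    using hom that by (simp add: LinearCombinations.module_hom_def)
  have "abelian_group W"
  proof (rule abelian_groupI)
    fix y assume "y \<in> carrier W"
    then obtain x where x: "x \<in> carrier V" "y = \<phi> x" unfolding W by blast
    then show "\<exists>z\<in>carrier W. z \<oplus>\<^bsub>W\<^esub> y = \<zero>\<^bsub>W\<^esub>"
      by (intro bexI[of _ "\<phi> (\<ominus>\<^bsub>V\<^esub> x)"]) (simp_all add: W add zero[symmetric] V.M.l_neg)
  qed (auto simp: W add zero[symmetric] V.M.a_ac)
  moreover have "module_axioms K W"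
    by (rule module_axioms.intro)
      (auto simp: W add smult V.smult_l_distr V.smult_r_distr V.smult_assoc1)
  ultimately show ?thesis
    by (intro vectorspace.intro Module.module.intro V.field_axioms V.R.cring_axioms)
qed

text \<open>Every element of W is some \<open>\<phi> x\<close>, so linearity of g on W reduces to
  linearity of f on V, without any axiom for W or W'.\<close>

lemma module_hom_transport:
  assumes f: "f \<in> LinearCombinations.module_hom K V V'"
    and \<phi>: "\<phi> \<in> LinearCombinations.module_hom K V W" "\<phi> ` carrier V = carrier W"
    and \<phi>': "\<phi>' \<in> LinearCombinations.module_hom K V' W'"
    and V: "vectorspace K V"
    and eq: "\<And>x. x \<in> carrier V \<Longrightarrow> g (\<phi> x) = \<phi>' (f x)"
  shows "g \<in> LinearCombinations.module_hom K W W'"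
proof -
  interpret V: vectorspace K V by fact
  have "\<phi> x \<oplus>\<^bsub>W\<^esub> \<phi> y = \<phi> (x \<oplus>\<^bsub>V\<^esub> y)" if "x \<in> carrier V" "y \<in> carrier V" for x y
    using \<phi> that by (simp add: LinearCombinations.module_hom_def)
  moreover have "c \<odot>\<^bsub>W\<^esub> \<phi> x = \<phi> (c \<odot>\<^bsub>V\<^esub> x)" if "c \<in> carrier K" "x \<in> carrier V" for c x
    using \<phi> that by (simp add: LinearCombinations.module_hom_def)
  ultimately show ?thesis
    using f \<phi>' eq unfolding LinearCombinations.module_hom_def \<phi>(2)[symmetric]
    by (auto simp: Pi_iff)
qed

lemma map2_update:
  "\<lbrakk>length ks = length ys; i < length ks\<rbrakk> \<Longrightarrow> map2 f ks (ys[i := y]) = (map2 f ks ys)[i := f (ks ! i) y]"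
  by (rule nth_equalityI) (auto simp: nth_list_update)

lemma map2_concat:
  "list_all2 (\<lambda>xs ys. length xs = length ys) xss yss \<Longrightarrow>
    concat (map2 (map2 f) xss yss) = map2 f (concat xss) (concat yss)"
  by (induction rule: list_all2_induct) auto

text \<open>All elements of Q lift to P and all operations agree there, so each axiom of Q is the
  image of one of P. This makes the quotient an operad without working on cosets.\<close>

lemma operad_iso_transport:
  fixes P :: "('k::field, 'a) nsop" and Q :: "('k, 'b) nsop"
  assumes P: "ns_operad P"
    and hom: "\<And>n. 1 \<le> n \<Longrightarrow> \<phi> n \<in> LinearCombinations.module_hom class_ring (comps P n) (comps Q n)"
    and bij: "\<And>n. 1 \<le> n \<Longrightarrow> bij_betw (\<phi> n) (carrier (comps P n)) (carrier (comps Q n))"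
    and zero: "\<And>n. 1 \<le> n \<Longrightarrow> \<phi> n \<zero>\<^bsub>comps P n\<^esub> = \<zero>\<^bsub>comps Q n\<^esub>"
    and unit: "\<phi> 1 (oper_unit P) = oper_unit Q"
    and compo: "\<And>ks x ys. \<lbrakk>valid_arities ks; x \<in> carrier (comps P (length ks)); inputs P ks ys\<rbrakk> \<Longrightarrow>
      \<phi> (sum_list ks) (compo P ks x ys) = compo Q ks (\<phi> (length ks) x) (map2 \<phi> ks ys)"
  shows "operad_iso P Q \<phi>"
proof -
  interpret P: ns_operad P by fact
  have image: "\<phi> n ` carrier (comps P n) = carrier (comps Q n)" if "1 \<le> n" for n
    using bij[OF that] by (simp add: bij_betw_def)
  have inputs: "\<exists>ys'. inputs P ks ys' \<and> ys = map2 \<phi> ks ys'"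
    if "\<forall>k\<in>set ks. 1 \<le> k" "inputs Q ks ys" for ks ys
  proof -
    have "list_all2 (\<lambda>k y. y \<in> carrier (comps Q k)) ks ys"
      using that(2) by (simp add: inputs_def)
    then show ?thesis using that(1)
    proof (induction rule: list_all2_induct)
      case (Cons k ks y ys)
      then obtain ys' where "inputs P ks ys'" "ys = map2 \<phi> ks ys'"
        by auto
      moreover have "y \<in> \<phi> k ` carrier (comps P k)"
        using Cons image[of k] by simp
      then obtain y' where "y' \<in> carrier (comps P k)" "y = \<phi> k y'"
        by blast
      ultimately show ?case
        by (intro exI[of _ "y' # ys'"]) (auto simp: inputs_def)
    qed (simp add: inputs_def)
  qed
  have "ns_operad Q"
  proof (rule ns_operad.intro)
    show "vectorspace class_ring (comps Q n)" if "1 \<le> n" for n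
      using vectorspace_transport[OF P.vectorspace_comps bij hom zero] that by blast
    show "oper_unit Q \<in> carrier (comps Q 1)"
      using imageI[OF P.unit_closed, of "\<phi> 1"] unfolding image[OF order_refl] unit .
  next
    fix ks ys assume ks: "valid_arities ks" and ys: "inputs Q ks ys"
    then obtain ys' where ys': "inputs P ks ys'" "ys = map2 \<phi> ks ys'"
      using inputs by (auto simp: valid_arities_def)
    show "(\<lambda>x. compo Q ks x ys) \<in> LinearCombinations.module_hom class_ring
        (comps Q (length ks)) (comps Q (sum_list ks))"
      using valid_arities_length[OF ks] valid_arities_sum_list[OF ks]
      by (intro module_hom_transport[OF P.linear_outer[OF ks ys'(1)] hom image hom P.vectorspace_comps])
        (simp_all add: ys' compo[OF ks _ ys'(1)])
    fix x i assume "x \<in> carrier (comps Q (length ks))" and i: "i < length ks"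
    then obtain x' where x': "x' \<in> carrier (comps P (length ks))" "x = \<phi> (length ks) x'"
      using image[OF valid_arities_length[OF ks]] by blast
    have eq: "compo Q ks x (ys[i := \<phi> (ks ! i) y]) = \<phi> (sum_list ks) (compo P ks x' (ys'[i := y]))"
      if "y \<in> carrier (comps P (ks ! i))" for y
      using compo[OF ks x'(1) inputs_update[OF ys'(1) i that]] x' ys' i
      by (simp add: map2_update inputs_length)
    show "(\<lambda>y. compo Q ks x (ys[i := y])) \<in> LinearCombinations.module_hom class_ring
        (comps Q (ks ! i)) (comps Q (sum_list ks))"
      using valid_arities_nth[OF ks i] valid_arities_sum_list[OF ks]
      by (intro module_hom_transport[OF P.linear_inner[OF ks x'(1) ys'(1) i] hom image hom P.vectorspace_comps])
        (simp_all add: eq)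
  next
    fix k y assume k: "1 \<le> k" and "y \<in> carrier (comps Q k)"
    then obtain y' where y': "y' \<in> carrier (comps P k)" "y = \<phi> k y'"
      using image by blast
    then show "compo Q [k] (oper_unit Q) [y] = y"
      using compo[of "[k]" "oper_unit P" "[y']"] P.unit_closed k unit P.unit_left[OF k y'(1)]
      by (simp add: valid_arities_def inputs_def)
  next
    fix n x assume n: "1 \<le> n" and "x \<in> carrier (comps Q n)"
    then obtain x' where x': "x' \<in> carrier (comps P n)" "x = \<phi> n x'"
      using image by blast
    have "map2 \<phi> (replicate n 1) (replicate n (oper_unit P)) = replicate n (oper_unit Q)"
      using unit by (intro nth_equalityI) auto
    then show "compo Q (replicate n 1) x (replicate n (oper_unit Q)) = x"
      using compo[of "replicate n 1" x' "replicate n (oper_unit P)"] P.unit_closed n x' P.unit_right[OF n x'(1)]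
      by (simp add: valid_arities_def inputs_def list_all2_conv_all_nth sum_list_replicate)
  next
    fix kss x ys zss
    assume kss: "kss \<noteq> []" "\<forall>ks\<in>set kss. valid_arities ks"
      and x: "x \<in> carrier (comps Q (length kss))"
      and ys: "inputs Q (map length kss) ys" and zss: "list_all2 (inputs Q) kss zss"
    obtain x' where x': "x' \<in> carrier (comps P (length kss))" "x = \<phi> (length kss) x'"
      using image[of "length kss"] x kss(1) by (cases kss) auto
    obtain ys' where ys': "inputs P (map length kss) ys'" "ys = map2 \<phi> (map length kss) ys'"
      using inputs[OF _ ys] valid_arities_map_length[OF kss] by (auto simp: valid_arities_def)
    have "\<exists>zss'. list_all2 (inputs P) kss zss' \<and> zss = map2 (map2 \<phi>) kss zss'"
      using zss kss(2)
    proof (induction rule: list_all2_induct)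
      case (Cons ks kss zs zss)
      then obtain zss' zs' where "list_all2 (inputs P) kss zss'" "zss = map2 (map2 \<phi>) kss zss'"
        "inputs P ks zs'" "zs = map2 \<phi> ks zs'"
        using inputs[of ks zs] by (auto simp: valid_arities_def)
      then show ?case
        by (intro exI[of _ "zs' # zss'"]) auto
    qed simp
    then obtain zss' where zss': "list_all2 (inputs P) kss zss'" "zss = map2 (map2 \<phi>) kss zss'"
      by blast
    have len: "length ys' = length kss" "length zss' = length kss"
      using ys' zss' by (auto dest: inputs_length list_all2_lengthD)
    have "list_all2 (\<lambda>ks zs. length ks = length zs) kss zss'"
      using zss'(1) by (rule list_all2_mono) (simp add: inputs_length)
    then have concat: "concat zss = map2 \<phi> (concat kss) (concat zss')"
      unfolding zss'(2) by (rule map2_concat)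
    have sums: "sum_list (map length kss) = length (concat kss)"
      "sum_list (map sum_list kss) = sum_list (concat kss)"
      by (simp add: length_concat) (induction kss; simp)
    have xy: "compo P (map length kss) x' ys' \<in> carrier (comps P (length (concat kss)))"
      using P.compo_closed[OF valid_arities_map_length[OF kss] _ ys'(1), of x'] x' by (simp add: sums)
    let ?yz = "map2 (\<lambda>ks (y, zs). compo P ks y zs) kss (zip ys' zss')"
    have yz: "map2 (\<lambda>ks (y, zs). compo Q ks y zs) kss (zip ys zss) = map2 \<phi> (map sum_list kss) ?yz"
    proof (rule nth_equalityI)
      fix i assume "i < length (map2 (\<lambda>ks (y, zs). compo Q ks y zs) kss (zip ys zss))"
      then have i: "i < length kss" by simp
      then have "valid_arities (kss ! i)" "inputs P (kss ! i) (zss' ! i)"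
        using kss zss'(1) by (auto simp: list_all2_conv_all_nth)
      then show "map2 (\<lambda>ks (y, zs). compo Q ks y zs) kss (zip ys zss) ! i = map2 \<phi> (map sum_list kss) ?yz ! i"
        using i len inputs_nth[OF ys'(1), of i] ys'(2) zss'(2) by (simp add: compo)
    qed (use len ys'(2) zss'(2) in simp)
    have "compo Q (concat kss) (compo Q (map length kss) x ys) (concat zss) =
        \<phi> (sum_list (concat kss)) (compo P (concat kss) (compo P (map length kss) x' ys') (concat zss'))"
      using compo[OF valid_arities_map_length[OF kss] _ ys'(1), of x']
        compo[OF valid_arities_concat[OF kss] xy inputs_concat[OF zss'(1)]] x' ys'(2)
      by (simp add: sums concat)
    also have "\<dots> = \<phi> (sum_list (map sum_list kss)) (compo P (map sum_list kss) x' ?yz)"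
      using P.assoc[OF kss x'(1) ys'(1) zss'(1)] by (simp add: sums)
    also have "\<dots> = compo Q (map sum_list kss) x (map2 (\<lambda>ks (y, zs). compo Q ks y zs) kss (zip ys zss))"
      using compo[OF valid_arities_map_sum_list[OF kss] _ P.inputs_compo[OF kss(2) ys'(1) zss'(1)], of x'] x'
      by (simp add: yz)
    finally show "compo Q (concat kss) (compo Q (map length kss) x ys) (concat zss) =
        compo Q (map sum_list kss) x (map2 (\<lambda>ks (y, zs). compo Q ks y zs) kss (zip ys zss))" .
  qed
  then show ?thesis
    by (intro operad_iso.intro operad_iso_axioms.intro P hom bij unit compo)
qed

text \<open>The cosets of the kernel of a linear map are its nonempty fibres, so taking y to its
  fibre inverts the map induced on the quotient.\<close>

definition fibre :: "('a \<Rightarrow> 'b) \<Rightarrow> 'a set \<Rightarrow> 'b \<Rightarrow> 'a set" where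
  "fibre f A y = {x \<in> A. f x = y}"

text \<open>The first isomorphism theorem, read from the image to the quotient. In this direction no
  representative has to be chosen, and the structure of U can be transported to the cosets.\<close>

lemma quotient_space_fibres:
  assumes V: "vectorspace K V" and U: "vectorspace K U"
    and hom: "\<psi> \<in> LinearCombinations.module_hom K V U" and surj: "\<psi> ` carrier V = carrier U"
    and J: "J = fibre \<psi> (carrier V) \<zero>\<^bsub>U\<^esub>"
  shows coset_eq_fibre: "x \<in> carrier V \<Longrightarrow> J +>\<^bsub>V\<^esub> x = fibre \<psi> (carrier V) (\<psi> x)"
    and fibre_hom: "fibre \<psi> (carrier V) \<in> LinearCombinations.module_hom K U (quotient_space V J)"
    and fibre_bij: "bij_betw (fibre \<psi> (carrier V)) (carrier U) (carrier (quotient_space V J))"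
    and fibre_zero: "fibre \<psi> (carrier V) \<zero>\<^bsub>U\<^esub> = \<zero>\<^bsub>quotient_space V J\<^esub>"
proof -
  interpret V: vectorspace K V by fact
  interpret U: vectorspace K U by fact
  let ?F = "fibre \<psi> (carrier V)"
  have add: "\<psi> (x \<oplus>\<^bsub>V\<^esub> y) = \<psi> x \<oplus>\<^bsub>U\<^esub> \<psi> y" if "x \<in> carrier V" "y \<in> carrier V" for x y
    using hom that by (simp add: LinearCombinations.module_hom_def)
  have smult: "\<psi> (c \<odot>\<^bsub>V\<^esub> x) = c \<odot>\<^bsub>U\<^esub> \<psi> x" if "c \<in> carrier K" "x \<in> carrier V" for c x
    using hom that by (simp add: LinearCombinations.module_hom_def)
  have closed: "\<psi> x \<in> carrier U" if "x \<in> carrier V" for x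
    using hom that by (auto simp: LinearCombinations.module_hom_def)
  have diff: "(w \<ominus>\<^bsub>V\<^esub> u) \<oplus>\<^bsub>V\<^esub> u = w" if "w \<in> carrier V" "u \<in> carrier V" for w u
    using that by (simp add: a_minus_def V.M.a_assoc V.M.l_neg)
  have coset: "J +>\<^bsub>V\<^esub> x = ?F (\<psi> x)" if x: "x \<in> carrier V" for x
  proof
    show "J +>\<^bsub>V\<^esub> x \<subseteq> ?F (\<psi> x)"
      using x closed by (auto simp: a_r_coset_def' J fibre_def add)
    show "?F (\<psi> x) \<subseteq> J +>\<^bsub>V\<^esub> x"
    proof
      fix y assume "y \<in> ?F (\<psi> x)"
      then have y: "y \<in> carrier V" "\<psi> y = \<psi> x" by (auto simp: fibre_def)
      have "\<psi> (y \<ominus>\<^bsub>V\<^esub> x) \<oplus>\<^bsub>U\<^esub> \<psi> x = \<zero>\<^bsub>U\<^esub> \<oplus>\<^bsub>U\<^esub> \<psi> x"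
        using x y closed by (simp add: add[symmetric] diff)
      then have "\<psi> (y \<ominus>\<^bsub>V\<^esub> x) = \<zero>\<^bsub>U\<^esub>"
        using closed[of "y \<ominus>\<^bsub>V\<^esub> x"] closed[of x] x y by (metis U.M.add.right_cancel U.M.zero_closed V.M.minus_closed)
      then show "y \<in> J +>\<^bsub>V\<^esub> x"
        unfolding a_r_coset_def' J fibre_def
        using x y diff[of y x] by (intro UN_I[of "y \<ominus>\<^bsub>V\<^esub> x"]) simp_all
    qed
  qed
  then show "x \<in> carrier V \<Longrightarrow> J +>\<^bsub>V\<^esub> x = ?F (\<psi> x)" .
  \<comment> \<open>Surjectivity enters here: a multiple of a coset is a union over its elements,
    which would be empty over an empty fibre.\<close>
  have nonempty: "?F y \<noteq> {}" if "y \<in> carrier U" for y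
    using that unfolding surj[symmetric] by (auto simp: fibre_def)
  have image: "carrier (quotient_space V J) = ?F ` carrier U"
    unfolding surj[symmetric] by (auto simp: quotient_space_def A_RCOSETS_def' coset)
  show "bij_betw ?F (carrier U) (carrier (quotient_space V J))"
  proof -
    have "inj_on ?F (carrier U)"
    proof (rule inj_onI)
      fix y z assume "y \<in> carrier U" "?F y = ?F z"
      with nonempty[of y] show "y = z" by (auto simp: fibre_def)
    qed
    then show ?thesis by (simp add: bij_betw_def image)
  qed
  show "?F \<zero>\<^bsub>U\<^esub> = \<zero>\<^bsub>quotient_space V J\<^esub>"
    by (simp add: quotient_space_def J)
  have "?F (y \<oplus>\<^bsub>U\<^esub> z) = ?F y \<oplus>\<^bsub>quotient_space V J\<^esub> ?F z" if y: "y \<in> carrier U" and z: "z \<in> carrier U" for y z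
  proof
    show "?F y \<oplus>\<^bsub>quotient_space V J\<^esub> ?F z \<subseteq> ?F (y \<oplus>\<^bsub>U\<^esub> z)"
      by (auto simp: quotient_space_def set_add_def' fibre_def add)
    show "?F (y \<oplus>\<^bsub>U\<^esub> z) \<subseteq> ?F y \<oplus>\<^bsub>quotient_space V J\<^esub> ?F z"
    proof
      fix w assume "w \<in> ?F (y \<oplus>\<^bsub>U\<^esub> z)"
      then have w: "w \<in> carrier V" "\<psi> w = y \<oplus>\<^bsub>U\<^esub> z" by (auto simp: fibre_def)
      obtain v where v: "v \<in> carrier V" "\<psi> v = z"
        using nonempty[OF z] by (auto simp: fibre_def)
      have "\<psi> (w \<ominus>\<^bsub>V\<^esub> v) \<oplus>\<^bsub>U\<^esub> z = y \<oplus>\<^bsub>U\<^esub> z"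
        using v w by (metis V.M.minus_closed add diff)
      then have "\<psi> (w \<ominus>\<^bsub>V\<^esub> v) = y"
        using closed[of "w \<ominus>\<^bsub>V\<^esub> v"] v w y z by simp
      then show "w \<in> ?F y \<oplus>\<^bsub>quotient_space V J\<^esub> ?F z"
        using v w diff[of w v] unfolding quotient_space_def set_add_def' fibre_def ring_record_simps
        by (intro UN_I[of "w \<ominus>\<^bsub>V\<^esub> v"] UN_I[of v]) simp_all
    qed
  qed
  moreover have "?F (c \<odot>\<^bsub>U\<^esub> y) = c \<odot>\<^bsub>quotient_space V J\<^esub> ?F y" if "c \<in> carrier K" "y \<in> carrier U" for c y
  proof -
    \<comment> \<open>All representatives give the same coset, so the union that defines the
      multiple is this coset.\<close>
    have "J +>\<^bsub>V\<^esub> (c \<odot>\<^bsub>V\<^esub> x) = ?F (c \<odot>\<^bsub>U\<^esub> y)" if "x \<in> ?F y" for x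
      using that \<open>c \<in> carrier K\<close> by (auto simp: fibre_def[of _ _ y] coset smult)
    then show ?thesis
      using nonempty[OF that(2)] by (auto simp: quotient_space_def)
  qed
  ultimately show "?F \<in> LinearCombinations.module_hom K U (quotient_space V J)"
    by (auto simp: LinearCombinations.module_hom_def image)
qed

text \<open>F has to provide only vector spaces, a unit and closed compositions. Associativity in
  the quotient comes from Q, so associativity of grafting is never proved.\<close>

lemma quotient_operad_iso:
  fixes F :: "('k::field, 'a) nsop" and Q :: "('k, 'b) nsop"
  assumes Q: "ns_operad Q"
    and F: "\<And>n. 1 \<le> n \<Longrightarrow> vectorspace class_ring (comps F n)"
    and unit_closed: "oper_unit F \<in> carrier (comps F 1)"
    and compo_closed: "\<And>ks x ys. \<lbrakk>valid_arities ks; x \<in> carrier (comps F (length ks)); inputs F ks ys\<rbrakk> \<Longrightarrow>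
      compo F ks x ys \<in> carrier (comps F (sum_list ks))"
    and hom: "\<And>n. 1 \<le> n \<Longrightarrow> \<psi> n \<in> LinearCombinations.module_hom class_ring (comps F n) (comps Q n)"
    and surj: "\<And>n. 1 \<le> n \<Longrightarrow> \<psi> n ` carrier (comps F n) = carrier (comps Q n)"
    and unit: "\<psi> 1 (oper_unit F) = oper_unit Q"
    and compo: "\<And>ks x ys. \<lbrakk>valid_arities ks; x \<in> carrier (comps F (length ks)); inputs F ks ys\<rbrakk> \<Longrightarrow>
      \<psi> (sum_list ks) (compo F ks x ys) = compo Q ks (\<psi> (length ks) x) (map2 \<psi> ks ys)"
    and J: "\<And>n. 1 \<le> n \<Longrightarrow> J n = {x \<in> carrier (comps F n). \<psi> n x = \<zero>\<^bsub>comps Q n\<^esub>}"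
  shows "operad_iso Q (quotient_operad F J) (\<lambda>n. fibre (\<psi> n) (carrier (comps F n)))"
proof (rule operad_iso_transport[OF Q])
  interpret Q: ns_operad Q by fact
  note fibres = quotient_space_fibres[OF F Q.vectorspace_comps hom surj J[folded fibre_def]]
  let ?\<phi> = "\<lambda>n. fibre (\<psi> n) (carrier (comps F n))"
  have comps: "comps (quotient_operad F J) n = quotient_space (comps F n) (J n)" for n
    by (simp add: quotient_operad_def)
  show "?\<phi> n \<in> LinearCombinations.module_hom class_ring (comps Q n) (comps (quotient_operad F J) n)"
    "bij_betw (?\<phi> n) (carrier (comps Q n)) (carrier (comps (quotient_operad F J) n))"
    "?\<phi> n \<zero>\<^bsub>comps Q n\<^esub> = \<zero>\<^bsub>comps (quotient_operad F J) n\<^esub>" if "1 \<le> n" for n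
    unfolding comps using fibres that by blast+
  show "?\<phi> 1 (oper_unit Q) = oper_unit (quotient_operad F J)"
    using fibres(1)[OF order_refl order_refl order_refl order_refl order_refl unit_closed] unit
    by (simp add: quotient_operad_def)
  fix ks x and ys :: "'b list"
  assume ks: "valid_arities ks" and x: "x \<in> carrier (comps Q (length ks))" and ys: "inputs Q ks ys"
  have len: "length ys = length ks"
    using ys by (rule inputs_length)
  let ?s = "sum_list ks"
  \<comment> \<open>The coset of a composite depends only on the images of the representatives,
    since J is the kernel and \<open>\<psi>\<close> respects compositions.\<close>
  have eq: "J ?s +>\<^bsub>comps F ?s\<^esub> compo F ks x' ys' = ?\<phi> ?s (compo Q ks x ys)"
    if x': "x' \<in> ?\<phi> (length ks) x" and ys': "ys' \<in> listset (map2 ?\<phi> ks ys)" for x' ys'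
  proof -
    have *: "x' \<in> carrier (comps F (length ks))" "\<psi> (length ks) x' = x"
      using x' by (auto simp: fibre_def)
    have "length ys' = length ks"
      using ys' len by (auto simp: in_listset dest: list_all2_lengthD)
    moreover have "ys' ! i \<in> carrier (comps F (ks ! i)) \<and> \<psi> (ks ! i) (ys' ! i) = ys ! i" if "i < length ks" for i
      using ys' len that by (auto simp: in_listset list_all2_conv_all_nth fibre_def)
    ultimately have "inputs F ks ys'" "map2 \<psi> ks ys' = ys"
      using len by (auto simp: inputs_def list_all2_conv_all_nth intro!: nth_equalityI)
    then show ?thesis
      using fibres(1) compo_closed[OF ks *(1)] compo[OF ks *(1)] *(2) valid_arities_sum_list[OF ks] by auto
  qed
  \<comment> \<open>Both families of representatives are nonempty, so the union in
    \<open>quotient_operad\<close> is the common coset and not the empty set.\<close>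
  have "?\<phi> (length ks) x \<noteq> {}"
    using x unfolding surj[OF valid_arities_length[OF ks], symmetric] by (auto simp: fibre_def)
  moreover have "listset (map2 ?\<phi> ks ys) \<noteq> {}"
  proof -
    have "\<exists>z. z \<in> carrier (comps F (ks ! i)) \<and> \<psi> (ks ! i) z = ys ! i" if "i < length ks" for i
      using inputs_nth[OF ys that] surj[OF valid_arities_nth[OF ks that]] by (metis imageE)
    then obtain g where "\<And>i. i < length ks \<Longrightarrow> g i \<in> carrier (comps F (ks ! i)) \<and> \<psi> (ks ! i) (g i) = ys ! i"
      by metis
    then have "map g [0..<length ks] \<in> listset (map2 ?\<phi> ks ys)"
      using len by (simp add: in_listset list_all2_conv_all_nth fibre_def)
    then show ?thesis by blast
  qed
  ultimately show "?\<phi> ?s (compo Q ks x ys) =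
      compo (quotient_operad F J) ks (?\<phi> (length ks) x) (map2 ?\<phi> ks ys)"
    using eq by (auto simp: quotient_operad_def)
qed

section \<open>The free operad on the dual generators\<close>

definition kronecker :: "'x \<Rightarrow> 'x \<Rightarrow> 'k::field" where
  "kronecker x = (\<lambda>y. if y = x then 1 else 0)"

text \<open>The labels of trees are functions; injectivity lets each be read back as the pair of
  letters to which it is dual.\<close>

lemma kronecker_eq_iff [simp]: "(kronecker x :: 'x \<Rightarrow> 'k::field) = kronecker y \<longleftrightarrow> x = y"
  by (metis kronecker_def zero_neq_one)

lemma dual_basis_eq: "dual_basis X = kronecker ` X"
  by (simp add: dual_basis_def kronecker_def[abs_def])

text \<open>The generator dual to \<open>(a, b)\<close> stands for the word with letters a and b,
  and a composition in P keeps a word only if the values of its blocks fit; so these are the words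
  that occur in the image of the tree. A leaf accepts every letter because the unit is the sum of
  all letters.\<close>

fun matches :: "('w \<Rightarrow> 'w \<Rightarrow> 'w) \<Rightarrow> ('w \<times> 'w \<Rightarrow> 'k::field) tree \<Rightarrow> 'w list \<Rightarrow> bool" where
  "matches arr \<langle>\<rangle> w \<longleftrightarrow> length w = 1"
| "matches arr \<langle>l, f, r\<rangle> w \<longleftrightarrow> matches arr l (take (size1 l) w) \<and> matches arr r (drop (size1 l) w) \<and>
    f = kronecker (word_value arr (take (size1 l) w), word_value arr (drop (size1 l) w))"

lemma matches_length: "matches arr t w \<Longrightarrow> length w = size1 t"
proof (induction t arbitrary: w)
  case (Node l f r)
  then have "length (take (size1 l) w) = size1 l" "length (drop (size1 l) w) = size1 r"
    by (simp_all only: matches.simps)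
  then show ?case
    using size1_ge0[of r] by simp
qed simp

lemma matches_node_append:
  "length u = size1 l \<Longrightarrow> matches arr \<langle>l, f, r\<rangle> (u @ v) \<longleftrightarrow>
    matches arr l u \<and> matches arr r v \<and> f = kronecker (word_value arr u, word_value arr v)"
  by simp

lemma matches_nodeE:
  assumes "matches arr \<langle>l, f, r\<rangle> w"
  obtains u v where "w = u @ v" "matches arr l u" "matches arr r v"
    "f = kronecker (word_value arr u, word_value arr v)"
  using assms by (metis append_take_drop_id matches.simps(2))

text \<open>The root label fixes the values of both subwords. Below a leaf the subword is a letter,
  hence equal to its value; below a larger subtree the induction hypothesis decides. The trivial
  tree accepts every letter and is excluded.\<close>

lemma matches_unique:
  assumes "matches arr t w" "matches arr t w'" "t \<noteq> \<langle>\<rangle>"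
  shows "w = w'"
  using assms
proof (induction t arbitrary: w w')
  case (Node l f r)
  obtain u v where w: "w = u @ v" "matches arr l u" "matches arr r v"
    "f = kronecker (word_value arr u, word_value arr v)"
    using Node.prems(1) by (rule matches_nodeE)
  obtain u' v' where w': "w' = u' @ v'" "matches arr l u'" "matches arr r v'"
    "f = kronecker (word_value arr u', word_value arr v')"
    using Node.prems(2) by (rule matches_nodeE)
  have eq: "word_value arr u = word_value arr u'" "word_value arr v = word_value arr v'"
    using w(4) w'(4) by auto
  have single: "x = y" if "length x = 1" "length y = 1" "word_value arr x = word_value arr y" for x y
    using that by (auto simp: length_Suc_conv)
  have "u = u'"
    using Node.IH(1)[OF w(2) w'(2)] single[of u u'] w(2) w'(2) eq by (cases "l = \<langle>\<rangle>") auto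
  moreover have "v = v'"
    using Node.IH(2)[OF w(3) w'(3)] single[of v v'] w(3) w'(3) eq by (cases "r = \<langle>\<rangle>") auto
  ultimately show ?case using w w' by simp
qed simp

section \<open>Grafting and the words carried by trees\<close>

lemma size1_graft: "length ts = size1 t \<Longrightarrow> size1 (graft t ts) = sum_list (map size1 ts)"
proof (induction t arbitrary: ts)
  case Leaf
  then show ?case by (auto simp: length_Suc_conv)
next
  case (Node l x r)
  have "sum_list (map size1 ts) =
      sum_list (map size1 (take (size1 l) ts)) + sum_list (map size1 (drop (size1 l) ts))"
    by (metis append_take_drop_id map_append sum_list_append)
  then show ?case using Node by simp
qed

lemma set_tree_graft:
  "length ts = size1 t \<Longrightarrow> set_tree (graft t ts) \<subseteq> set_tree t \<union> (\<Union>s\<in>set ts. set_tree s)"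
proof (induction t arbitrary: ts)
  case Leaf
  then show ?case by (auto simp: length_Suc_conv)
next
  case (Node l x r)
  have "set_tree (graft l (take (size1 l) ts)) \<subseteq> set_tree l \<union> (\<Union>s\<in>set (take (size1 l) ts). set_tree s)"
    "set_tree (graft r (drop (size1 l) ts)) \<subseteq> set_tree r \<union> (\<Union>s\<in>set (drop (size1 l) ts). set_tree s)"
    using Node by simp_all
  then show ?case
    using set_take_subset[of "size1 l" ts] set_drop_subset[of "size1 l" ts] by fastforce
qed

text \<open>Inside the grafted tree a vertex of t sees concatenations of blocks. By
  \<open>word_value_concat\<close> their values are those of the words of block values, so the
  conditions at the vertices of t are those of t alone on
  \<open>map (word_value arr) W\<close>.\<close>

lemma matches_graft:
  fixes arr :: "'w::finite \<Rightarrow> 'w \<Rightarrow> 'w" and t :: "('w \<times> 'w \<Rightarrow> 'k::field) tree"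
  assumes "semigroup arr" "length ts = size1 t" "map length W = map size1 ts"
  shows "matches arr (graft t ts) (concat W) \<longleftrightarrow>
    matches arr t (map (word_value arr) W) \<and> list_all2 (matches arr) ts W"
  using assms(2,3)
proof (induction t arbitrary: ts W)
  case Leaf
  then obtain s where ts: "ts = [s]" by (auto simp: length_Suc_conv)
  with Leaf obtain w where "W = [w]" by auto
  with ts show ?case by simp
next
  case (Node l f r)
  define ts1 ts2 where ts12: "ts1 = take (size1 l) ts" "ts2 = drop (size1 l) ts"
  define W1 W2 where W12: "W1 = take (size1 l) W" "W2 = drop (size1 l) W"
  have lenW: "length W = size1 l + size1 r"
    using Node.prems by (metis length_map size1_size tree.size(4) size1.simps(2))
  have len: "length ts1 = size1 l" "length ts2 = size1 r" "length W1 = size1 l" "length W2 = size1 r"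
    using Node.prems lenW by (auto simp: ts12 W12)
  have W: "W = W1 @ W2" and ts: "ts = ts1 @ ts2" by (simp_all add: ts12 W12)
  have maps: "map length W1 = map size1 ts1" "map length W2 = map size1 ts2"
    using Node.prems(2) by (simp_all add: ts12 W12 take_map[symmetric] drop_map[symmetric])
  have val: "word_value arr (concat V) = word_value arr (map (word_value arr) V)"
    if "map length V = map size1 us" "V \<noteq> []" for V and us :: "('w \<times> 'w \<Rightarrow> 'k) tree list"
  proof (rule word_value_concat[OF assms(1) that(2)])
    show "[] \<notin> set V"
    proof
      assume "[] \<in> set V"
      then have "0 \<in> set (map length V)" by force
      then show False unfolding that(1) using size1_ge0 by (metis (no_types, lifting) imageE less_numeral_extra(3) list.set_map)
    qed
  qed
  have "length (concat W1) = size1 (graft l ts1)"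
    using len maps by (simp add: size1_graft length_concat)
  moreover have "W1 \<noteq> []" "W2 \<noteq> []"
    using len size1_ge0 by (metis list.size(3) less_irrefl)+
  moreover have "list_all2 (matches arr) ts W \<longleftrightarrow> list_all2 (matches arr) ts1 W1 \<and> list_all2 (matches arr) ts2 W2"
    unfolding W ts using len by (simp add: list_all2_append)
  ultimately show ?case
    using Node.IH(1)[OF len(1) maps(1)] Node.IH(2)[OF len(2) maps(2)] val[OF maps(1)] val[OF maps(2)] len
    by (auto simp: W ts simp del: size1_size)
qed

text \<open>The normal forms. All one-letter words share the trivial tree, so a comb determines its
  word only from two letters on; for the empty word the trivial tree is a default value.\<close>

fun right_comb :: "('w \<Rightarrow> 'w \<Rightarrow> 'w) \<Rightarrow> 'w list \<Rightarrow> ('w \<times> 'w \<Rightarrow> 'k::field) tree" where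
  "right_comb arr (\<alpha> # \<beta> # w) = \<langle>\<langle>\<rangle>, kronecker (\<alpha>, word_value arr (\<beta> # w)), right_comb arr (\<beta> # w)\<rangle>"
| "right_comb arr _ = \<langle>\<rangle>"

lemma right_comb_Cons:
  "w \<noteq> [] \<Longrightarrow> right_comb arr (\<alpha> # w) = \<langle>\<langle>\<rangle>, kronecker (\<alpha>, word_value arr w), right_comb arr w\<rangle>"
  by (cases w) auto

lemma matches_right_comb: "w \<noteq> [] \<Longrightarrow> matches arr (right_comb arr w) w"
  by (induction arr w rule: right_comb.induct) auto

lemma size1_right_comb: "w \<noteq> [] \<Longrightarrow> size1 (right_comb arr w) = length w"
  using matches_length[OF matches_right_comb] by metis

lemma set_tree_right_comb: "set_tree (right_comb arr w) \<subseteq> dual_basis UNIV"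
  by (induction arr w rule: right_comb.induct) (auto simp: dual_basis_eq)

lemma matches_right_comb_iff:
  "2 \<le> length w \<Longrightarrow> matches arr (right_comb arr w :: (_ \<Rightarrow> 'k::field) tree) v \<longleftrightarrow> v = w"
proof -
  assume w: "2 \<le> length w"
  then have "w \<noteq> []" "right_comb arr w \<noteq> (\<langle>\<rangle> :: (_ \<Rightarrow> 'k) tree)"
    by (auto simp: numeral_2_eq_2 Suc_le_length_iff)
  then show ?thesis
    using matches_right_comb matches_unique by blast
qed

lemma finite_words: "finite {w :: 'w::finite list. length w = n}"
  using finite_lists_length_eq[of "UNIV :: 'w set" n] by simp

text \<open>Summing over all words treats three cases uniformly: no carried word gives 0, a
  nontrivial tree gives at most one word, and the trivial tree gives the sum of all letters. The
  bound on the length keeps the sum finite and loses nothing by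
  \<open>matches_length\<close>.\<close>

definition tree_words ::
    "('w::finite \<Rightarrow> 'w \<Rightarrow> 'w) \<Rightarrow> (('w \<times> 'w \<Rightarrow> 'k::field) tree \<Rightarrow>\<^sub>0 'k) \<Rightarrow> ('w list \<Rightarrow>\<^sub>0 'k)" where
  "tree_words arr = lin_ext (\<lambda>t. \<Sum>w | length w = size1 t. Poly_Mapping.single w (of_bool (matches arr t w)))"

lemma lookup_tree_words:
  fixes arr :: "'w::finite \<Rightarrow> 'w \<Rightarrow> 'w" and x :: "('w \<times> 'w \<Rightarrow> 'k::field) tree \<Rightarrow>\<^sub>0 'k"
  shows "Poly_Mapping.lookup (tree_words arr x) w =
    (\<Sum>t\<in>Poly_Mapping.keys x. Poly_Mapping.lookup x t * of_bool (matches arr t w))"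
proof -
  have "(\<Sum>v | length v = size1 t. Poly_Mapping.lookup
      (Poly_Mapping.single v (of_bool (matches arr t v) :: 'k)) w) = of_bool (matches arr t w)"
    for t :: "('w \<times> 'w \<Rightarrow> 'k) tree"
  proof (cases "length w = size1 t")
    case True
    then show ?thesis
      by (simp add: lookup_single when_def finite_words)
  next
    case False
    then have "\<not> matches arr t w" using matches_length by blast
    then show ?thesis using False
      by (auto simp: lookup_single when_def finite_words intro!: sum.neutral)
  qed
  then show ?thesis
    by (simp add: tree_words_def lookup_lin_ext lookup_sum)
qed

lemma tree_words_add: "tree_words arr (x + y) = tree_words arr x + tree_words arr y"
  and tree_words_diff: "tree_words arr (x - y) = tree_words arr x - tree_words arr y"
  and tree_words_scale: "tree_words arr (scale c x) = scale c (tree_words arr x)"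
  and tree_words_sum: "tree_words arr (sum f A) = (\<Sum>a\<in>A. tree_words arr (f a))"
  and tree_words_zero [simp]: "tree_words arr 0 = 0"
  by (simp_all add: tree_words_def lin_ext_add lin_ext_diff lin_ext_scale lin_ext_sum)

lemma lookup_tree_words_single:
  "Poly_Mapping.lookup (tree_words arr (Poly_Mapping.single t 1 :: _ \<Rightarrow>\<^sub>0 'k::field)) w =
    of_bool (matches arr t w)"
  by (simp add: lookup_tree_words)

section \<open>The morphism from trees to words\<close>

lemma comps_free_operad [simp]:
    "comps (free_operad X) n = free_space {t. size1 t = n \<and> set_tree t \<subseteq> X}"
  and oper_unit_free_operad [simp]: "oper_unit (free_operad X) = Poly_Mapping.single \<langle>\<rangle> 1"
  and compo_free_operad: "compo (free_operad X) ks =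
    multilinear_ext (\<lambda>t ts. Poly_Mapping.single (graft t ts) 1)"
  by (simp_all add: free_operad_def)

lemma size1_inputs_free_operad:
  assumes "inputs (free_operad X) ks ys" "list_all2 (\<lambda>b y. b \<in> Poly_Mapping.keys y) bs ys"
  shows "map size1 bs = ks" "\<forall>b\<in>set bs. set_tree b \<subseteq> X"
proof -
  have "list_all2 (\<lambda>b k. size1 b = k \<and> set_tree b \<subseteq> X) bs ks"
    using assms by (fastforce simp: inputs_def list_all2_conv_all_nth)
  then show "map size1 bs = ks" "\<forall>b\<in>set bs. set_tree b \<subseteq> X"
    by (induction rule: list_all2_induct) auto
qed

lemma compo_free_operad_closed:
  assumes x: "x \<in> carrier (comps (free_operad X) (length ks))" and ys: "inputs (free_operad X) ks ys"
  shows "compo (free_operad X) ks x ys \<in> carrier (comps (free_operad X) (sum_list ks))"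
proof -
  have "size1 (graft b bs) = sum_list ks \<and> set_tree (graft b bs) \<subseteq> X"
    if "b \<in> Poly_Mapping.keys x" "list_all2 (\<lambda>b y. b \<in> Poly_Mapping.keys y) bs ys" for b bs
  proof -
    have b: "size1 b = length ks" "set_tree b \<subseteq> X" using x that(1) by auto
    have bs: "map size1 bs = ks" "\<forall>b\<in>set bs. set_tree b \<subseteq> X"
      using size1_inputs_free_operad[OF ys that(2)] by auto
    have "length bs = size1 b" using b(1) bs(1) by (metis length_map)
    then show ?thesis
      using b bs set_tree_graft[of bs b] size1_graft[of bs b] by fastforce
  qed
  then show ?thesis
    unfolding compo_free_operad comps_free_operad carrier_free_space mem_Collect_eq
    by (intro keys_multilinear_ext) auto
qed

lemma tree_words_closed:
  assumes "x \<in> carrier (comps (free_operad X) n)"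
  shows "tree_words arr x \<in> carrier (comps (word_operad arr) n)"
proof -
  have "length w = n" if "w \<in> Poly_Mapping.keys (tree_words arr x)" for w
  proof -
    have "Poly_Mapping.lookup (tree_words arr x) w \<noteq> 0"
      using that by (simp add: in_keys_iff)
    then obtain t where "t \<in> Poly_Mapping.keys x"
      "Poly_Mapping.lookup x t * of_bool (matches arr t w) \<noteq> 0"
      unfolding lookup_tree_words by (rule sum.not_neutral_contains_not_neutral)
    moreover from this(2) have "matches arr t w" by (cases "matches arr t w") auto
    ultimately show ?thesis using assms matches_length by fastforce
  qed
  then show ?thesis by auto
qed

lemma tree_words_unit: "tree_words arr (Poly_Mapping.single \<langle>\<rangle> 1) = oper_unit (word_operad arr)"
  by (rule poly_mapping_eqI) (simp add: lookup_tree_words_single lookup_unit_word_operad)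

text \<open>At a word cut into blocks, \<open>matches_graft\<close> separates the condition on the
  outer tree from one condition per inserted tree. The sum over tuples of inserted trees then
  factors by distributivity into the coefficients of their images.\<close>

lemma tree_words_compo:
  assumes arr: "semigroup arr"
    and x: "x \<in> carrier (comps (free_operad X) (length ks))" and ys: "inputs (free_operad X) ks ys"
  shows "tree_words arr (compo (free_operad X) ks x ys) =
    compo (word_operad arr) ks (tree_words arr x) (map (tree_words arr) ys)"
proof (rule word_operad_eqI[of _ arr ks])
  have ys': "inputs (word_operad arr) ks (map (tree_words arr) ys)"
    using ys tree_words_closed unfolding inputs_def list_all2_map2 by (rule list_all2_mono)
  show "tree_words arr (compo (free_operad X) ks x ys) \<in> carrier (comps (word_operad arr) (sum_list ks))"
    by (rule tree_words_closed[OF compo_free_operad_closed[OF x ys]])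
  show "compo (word_operad arr) ks (tree_words arr x) (map (tree_words arr) ys)
      \<in> carrier (comps (word_operad arr) (sum_list ks))"
    by (rule compo_word_operad_closed[OF tree_words_closed[OF x] ys'])
  fix W :: "'a list list"
  assume W: "map length W = ks"
  have len: "length ys = length W"
    using inputs_length[OF ys] W by auto
  let ?B = "listset (map Poly_Mapping.keys ys)"
  let ?g = "\<lambda>y w t. Poly_Mapping.lookup y t * of_bool (matches arr t w)"
  have term_eq: "Poly_Mapping.lookup x b * (\<Prod>i<length ys. Poly_Mapping.lookup (ys ! i) (bs ! i)) *
        of_bool (matches arr (graft b bs) (concat W)) =
      Poly_Mapping.lookup x b * of_bool (matches arr b (map (word_value arr) W)) *
        prod_list (map2 (\<lambda>g b. g b) (map2 ?g ys W) bs)"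
    if b: "b \<in> Poly_Mapping.keys x" and bs: "bs \<in> ?B" for b bs
  proof -
    have "map size1 bs = ks" "size1 b = length ks" and lbs: "length bs = length W"
      using size1_inputs_free_operad(1)[OF ys] bs b x len
      by (auto simp: in_listset list_all2_map2 dest: list_all2_lengthD)
    then have "matches arr (graft b bs) (concat W) \<longleftrightarrow>
        matches arr b (map (word_value arr) W) \<and> list_all2 (matches arr) bs W"
      using W by (intro matches_graft[OF arr]) (auto dest: map_eq_imp_length_eq)
    moreover have "prod_list (map2 (\<lambda>g b. g b) (map2 ?g ys W) bs) =
        (\<Prod>i<length ys. Poly_Mapping.lookup (ys ! i) (bs ! i) * of_bool (matches arr (bs ! i) (W ! i)))"
      using len lbs by (simp add: prod.list_conv_set_nth atLeast0LessThan)
    moreover have "(\<Prod>i<length ys. of_bool (matches arr (bs ! i) (W ! i)) :: 'b) =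
        of_bool (list_all2 (matches arr) bs W)"
      using len lbs by (auto simp: list_all2_conv_all_nth)
    ultimately show ?thesis
      by (simp add: prod.distrib)
  qed
  have "Poly_Mapping.lookup (tree_words arr (compo (free_operad X) ks x ys)) (concat W) =
      (\<Sum>b\<in>Poly_Mapping.keys x. \<Sum>bs\<in>?B. Poly_Mapping.lookup x b *
        (\<Prod>i<length ys. Poly_Mapping.lookup (ys ! i) (bs ! i)) * of_bool (matches arr (graft b bs) (concat W)))"
    unfolding compo_free_operad multilinear_ext_def tree_words_sum tree_words_scale lookup_sum lookup_scale
      lookup_tree_words_single ..
  also have "\<dots> = (\<Sum>b\<in>Poly_Mapping.keys x. \<Sum>bs\<in>?B.
      Poly_Mapping.lookup x b * of_bool (matches arr b (map (word_value arr) W)) *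
        prod_list (map2 (\<lambda>g b. g b) (map2 ?g ys W) bs))"
    by (intro sum.cong refl term_eq)
  also have "\<dots> = Poly_Mapping.lookup (tree_words arr x) (map (word_value arr) W) *
      (\<Sum>bs\<in>?B. prod_list (map2 (\<lambda>g b. g b) (map2 ?g ys W) bs))"
    unfolding lookup_tree_words by (rule sum_product[symmetric])
  also have "(\<Sum>bs\<in>?B. prod_list (map2 (\<lambda>g b. g b) (map2 ?g ys W) bs)) =
      prod_list (map2 (\<lambda>g A. \<Sum>b\<in>A. g b) (map2 ?g ys W) (map Poly_Mapping.keys ys))"
    using len by (intro sum_listset_prod_list) simp
  also have "map2 (\<lambda>g A. \<Sum>b\<in>A. g b) (map2 ?g ys W) (map Poly_Mapping.keys ys) =
      map2 Poly_Mapping.lookup (map (tree_words arr) ys) W"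
    using len by (intro nth_equalityI) (simp_all add: lookup_tree_words)
  finally show "Poly_Mapping.lookup (tree_words arr (compo (free_operad X) ks x ys)) (concat W) =
      Poly_Mapping.lookup (compo (word_operad arr) ks (tree_words arr x) (map (tree_words arr) ys)) (concat W)"
    using lookup_compo_word_operad[OF W tree_words_closed[OF x] ys'] by simp
qed

section \<open>The relations of the Koszul dual\<close>

lemma circ_generator:
  "circ (free_operad X) 2 2 1 (generator x) (generator y) = Poly_Mapping.single \<langle>\<langle>\<langle>\<rangle>, y, \<langle>\<rangle>\<rangle>, x, \<langle>\<rangle>\<rangle> 1"
  "circ (free_operad X) 2 2 2 (generator x) (generator y) = Poly_Mapping.single \<langle>\<langle>\<rangle>, x, \<langle>\<langle>\<rangle>, y, \<langle>\<rangle>\<rangle>\<rangle> 1"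
  using multilinear_ext_single[of "\<lambda>t ts. Poly_Mapping.single (graft t ts) 1" "\<langle>\<langle>\<rangle>, x, \<langle>\<rangle>\<rangle>" "[\<langle>\<langle>\<rangle>, y, \<langle>\<rangle>\<rangle>, \<langle>\<rangle>]"]
    multilinear_ext_single[of "\<lambda>t ts. Poly_Mapping.single (graft t ts) 1" "\<langle>\<langle>\<rangle>, x, \<langle>\<rangle>\<rangle>" "[\<langle>\<rangle>, \<langle>\<langle>\<rangle>, y, \<langle>\<rangle>\<rangle>]"]
  by (simp_all add: circ_def generator_def compo_free_operad numeral_2_eq_2)

lemma pairing_diff_single:
  assumes "t \<noteq> t'"
  shows "pairing u (Poly_Mapping.single t 1 - Poly_Mapping.single t' 1) =
    (\<Sum>s\<in>Poly_Mapping.keys u. Poly_Mapping.lookup u s * (tree_pairing s t - tree_pairing s t'))"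
proof -
  have "Poly_Mapping.keys (Poly_Mapping.single t 1 - Poly_Mapping.single t' 1 :: _ \<Rightarrow>\<^sub>0 'b) = {t, t'}"
    using assms by (auto simp: set_eq_iff in_keys_iff lookup_minus lookup_single when_def)
  then show ?thesis
    using assms unfolding pairing_def
    by (intro sum.cong) (auto simp: lookup_minus lookup_single when_def algebra_simps)
qed

lemma size1_eq_3E:
  assumes "size1 t = 3"
  obtains (left) f g where "t = \<langle>\<langle>\<langle>\<rangle>, g, \<langle>\<rangle>\<rangle>, f, \<langle>\<rangle>\<rangle>" | (right) f g where "t = \<langle>\<langle>\<rangle>, f, \<langle>\<langle>\<rangle>, g, \<langle>\<rangle>\<rangle>\<rangle>"
proof -
  have leaf: "s = \<langle>\<rangle>" if "size1 s = 1" for s :: "'a tree"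
    using that by (cases s) (auto simp: size1_size)
  have cherry: "\<exists>g. s = \<langle>\<langle>\<rangle>, g, \<langle>\<rangle>\<rangle>" if "size1 s = 2" for s :: "'a tree"
    using that by (cases s) (auto simp: size1_size)
  obtain l f r where t: "t = \<langle>l, f, r\<rangle>"
    using assms by (cases t) auto
  have "size1 l + size1 r = 3" using assms t by simp
  moreover have "size1 l \<ge> 1" "size1 r \<ge> 1" by (simp_all add: Suc_le_eq)
  ultimately consider "size1 l = 1" "size1 r = 2" | "size1 l = 2" "size1 r = 1" by linarith
  then show ?thesis
    using that leaf cherry t by cases metis+
qed

lemma matches_left_tree:
  "matches arr \<langle>\<langle>\<langle>\<rangle>, g, \<langle>\<rangle>\<rangle>, f, \<langle>\<rangle>\<rangle> [\<alpha>, \<beta>, \<gamma>] \<longleftrightarrow> f = kronecker (arr \<alpha> \<beta>, \<gamma>) \<and> g = kronecker (\<alpha>, \<beta>)"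
  by (auto simp: word_value_def)

lemma matches_right_tree:
  "matches arr \<langle>\<langle>\<rangle>, f, \<langle>\<langle>\<rangle>, g, \<langle>\<rangle>\<rangle>\<rangle> [\<alpha>, \<beta>, \<gamma>] \<longleftrightarrow> f = kronecker (\<alpha>, arr \<beta> \<gamma>) \<and> g = kronecker (\<beta>, \<gamma>)"
  by (auto simp: word_value_def)

lemma kronecker_apply: "kronecker x y = of_bool (x = y)"
  by (auto simp: kronecker_def)

text \<open>A tree s of either shape pairs to 0 with one of the two monomials. The other contributes
  a product of two Kronecker values, always with sign plus since the two minus signs cancel, and
  these values test the labels of the two vertices of s.\<close>

lemma tree_pairing_relation:
  fixes s :: "('w \<times> 'w \<Rightarrow> 'k::field) tree"
  assumes "size1 s = 3" "set_tree s \<subseteq> dual_basis UNIV"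
  shows "tree_pairing s \<langle>\<langle>\<langle>\<rangle>, (\<alpha>, \<beta>), \<langle>\<rangle>\<rangle>, (arr \<alpha> \<beta>, \<gamma>), \<langle>\<rangle>\<rangle> -
    tree_pairing s \<langle>\<langle>\<rangle>, (\<alpha>, arr \<beta> \<gamma>), \<langle>\<langle>\<rangle>, (\<beta>, \<gamma>), \<langle>\<rangle>\<rangle>\<rangle> = of_bool (matches arr s [\<alpha>, \<beta>, \<gamma>])"
  using assms(1)
proof (cases rule: size1_eq_3E)
  case (left f g)
  then obtain p q where "f = kronecker p" "g = kronecker q"
    using assms(2) by (auto simp: dual_basis_eq)
  then show ?thesis
    unfolding left matches_left_tree by (simp add: kronecker_apply)
next
  case (right f g)
  then obtain p q where "f = kronecker p" "g = kronecker q"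
    using assms(2) by (auto simp: dual_basis_eq)
  then show ?thesis
    unfolding right matches_right_tree by (simp add: kronecker_apply)
qed

lemma tree_words_eq_0_iff:
  assumes "x \<in> carrier (comps (free_operad X) n)"
  shows "tree_words arr x = 0 \<longleftrightarrow> (\<forall>w. length w = n \<longrightarrow> Poly_Mapping.lookup (tree_words arr x) w = 0)"
proof
  assume *: "\<forall>w. length w = n \<longrightarrow> Poly_Mapping.lookup (tree_words arr x) w = 0"
  show "tree_words arr x = 0"
  proof (rule poly_mapping_eqI)
    fix w
    show "Poly_Mapping.lookup (tree_words arr x) w = Poly_Mapping.lookup 0 w"
    proof (cases "length w = n")
      case False
      then have "w \<notin> Poly_Mapping.keys (tree_words arr x)"
        using tree_words_closed[OF assms, of arr] by auto
      then show ?thesis by (simp add: not_in_keys_iff_lookup_eq_zero)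
    qed (use * in simp)
  qed
qed simp

text \<open>There is one relation for each word of length 3, and pairing with it extracts the
  coefficient of the image at that word.\<close>

lemma orthogonal_As2:
  fixes arr :: "'w::finite \<Rightarrow> 'w \<Rightarrow> 'w"
  defines "X \<equiv> dual_basis UNIV :: ('w \<times> 'w \<Rightarrow> 'k::field) set"
  shows "orthogonal UNIV (snd (As2_presentation arr)) =
    {u \<in> carrier (comps (free_operad X) 3). tree_words arr u = 0}"
proof -
  have "(\<forall>v\<in>snd (As2_presentation arr). pairing u v = 0) \<longleftrightarrow> tree_words arr u = 0"
    if u: "u \<in> carrier (comps (free_operad X) 3)" for u
  proof -
    have "pairing u (circ (free_operad UNIV) 2 2 1 (generator (arr \<alpha> \<beta>, \<gamma>)) (generator (\<alpha>, \<beta>)) -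
        circ (free_operad UNIV) 2 2 2 (generator (\<alpha>, arr \<beta> \<gamma>)) (generator (\<beta>, \<gamma>))) =
        Poly_Mapping.lookup (tree_words arr u) [\<alpha>, \<beta>, \<gamma>]" for \<alpha> \<beta> \<gamma>
      using u unfolding circ_generator lookup_tree_words
      by (subst pairing_diff_single, simp)
        (intro sum.cong refl arg_cong2[where f = "(*)"] tree_pairing_relation, auto simp: X_def)
    then have "(\<forall>v\<in>snd (As2_presentation arr). pairing u v = 0) \<longleftrightarrow>
        (\<forall>\<alpha> \<beta> \<gamma>. Poly_Mapping.lookup (tree_words arr u) [\<alpha>, \<beta>, \<gamma>] = 0)"
      by (fastforce simp: As2_presentation_def)
    also have "\<dots> \<longleftrightarrow> (\<forall>w. length w = 3 \<longrightarrow> Poly_Mapping.lookup (tree_words arr u) w = 0)"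
      by (auto simp: numeral_3_eq_3 length_Suc_conv)
    finally show ?thesis
      using tree_words_eq_0_iff[OF u] by simp
  qed
  then show ?thesis
    by (auto simp: orthogonal_def X_def)
qed

section \<open>Reduction to right combs\<close>

lemma matches_nonempty: "matches arr t w \<Longrightarrow> w \<noteq> []"
  by (metis list.size(3) matches_length nat_less_le size1_ge0)

lemma length_3E:
  assumes "length w = 3" obtains a b c where "w = [a, b, c]"
  using assms by (auto simp: numeral_3_eq_3 length_Suc_conv)

lemma matches_3_eqI:
  assumes "size1 s = 3" "size1 t = 3"
    and "\<And>a b c. matches arr s [a, b, c] \<longleftrightarrow> matches arr t [a, b, c]"
  shows "matches arr s w \<longleftrightarrow> matches arr t w"
  using assms by (metis length_3E matches_length)

definition dual_operad :: "('k::field, ('w \<times> 'w \<Rightarrow> 'k) tree \<Rightarrow>\<^sub>0 'k) nsop" where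
  "dual_operad = free_operad (dual_basis UNIV)"

definition labelled :: "('w \<times> 'w \<Rightarrow> 'k::field) tree \<Rightarrow> bool" where
  "labelled t \<longleftrightarrow> set_tree t \<subseteq> dual_basis UNIV"

lemma labelled_simps [simp]:
  "labelled \<langle>\<rangle>" "labelled \<langle>l, f, r\<rangle> \<longleftrightarrow> labelled l \<and> f \<in> dual_basis UNIV \<and> labelled r"
  "labelled (right_comb arr w)"
  using set_tree_right_comb by (auto simp: labelled_def)

lemma kronecker_in_dual_basis [simp]: "kronecker p \<in> dual_basis UNIV"
  by (simp add: dual_basis_eq)

lemma single_in_free_operad [simp]:
  "Poly_Mapping.single t (c::'k::field) \<in> carrier (comps dual_operad n) \<longleftrightarrow> c = 0 \<or> size1 t = n \<and> labelled t"
  by (auto simp: dual_operad_def labelled_def)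

text \<open>The ideal J is arbitrary rather than the generated one: the latter is an intersection,
  so the kernel is to be found inside every ideal containing the relations.\<close>

locale relation_ideal =
  fixes arr :: "'w::finite \<Rightarrow> 'w \<Rightarrow> 'w" and J :: "nat \<Rightarrow> (('w \<times> 'w \<Rightarrow> 'k::field) tree \<Rightarrow>\<^sub>0 'k) set"
  assumes semigroup: "semigroup arr"
    and ideal: "operad_ideal dual_operad J"
    and relations: "\<lbrakk>u \<in> carrier (comps dual_operad 3); tree_words arr u = 0\<rbrakk> \<Longrightarrow> u \<in> J 3"
begin

section \<open>Closure properties of the ideal\<close>

lemma subspace: "1 \<le> n \<Longrightarrow> VectorSpace.subspace class_ring (J n) (comps dual_operad n)"
  using ideal by (simp add: operad_ideal_def)

lemma
  assumes "1 \<le> n"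
  shows add_mem: "x \<in> J n \<Longrightarrow> y \<in> J n \<Longrightarrow> x + y \<in> J n"
    and zero_mem: "0 \<in> J n"
    and scale_mem: "x \<in> J n \<Longrightarrow> scale c x \<in> J n"
  using subspace[OF assms] by (simp_all add: VectorSpace.subspace_def submodule_def dual_operad_def)

lemma mem_carrier: "1 \<le> n \<Longrightarrow> x \<in> J n \<Longrightarrow> x \<in> carrier (comps dual_operad n)"
  using subspace[of n] unfolding VectorSpace.subspace_def submodule_def by blast

lemma sum_mem: "1 \<le> n \<Longrightarrow> (\<And>a. a \<in> A \<Longrightarrow> f a \<in> J n) \<Longrightarrow> sum f A \<in> J n"
  by (induction A rule: infinite_finite_induct) (auto simp: zero_mem add_mem)

lemma compo_mem:
  assumes "valid_arities ks" "x \<in> carrier (comps dual_operad (length ks))" "inputs dual_operad ks ys"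
    "x \<in> J (length ks) \<or> (\<exists>i<length ks. ys ! i \<in> J (ks ! i))"
  shows "compo dual_operad ks x ys \<in> J (sum_list ks)"
  using ideal assms by (auto simp: operad_ideal_def)

text \<open>The result is the two-leaf tree labelled \<open>f\<close> composed with x and r, which
  an ideal absorbs. Together with \<open>node_right_mem\<close> this allows reductions inside
  subtrees.\<close>

lemma node_left_mem:
  assumes "1 \<le> n" "x \<in> J n" "f \<in> dual_basis UNIV" "labelled r"
  shows "lin_ext (\<lambda>t. Poly_Mapping.single \<langle>t, f, r\<rangle> 1) x \<in> J (n + size1 r)"
proof -
  have "compo dual_operad [n, size1 r] (Poly_Mapping.single \<langle>\<langle>\<rangle>, f, \<langle>\<rangle>\<rangle> 1) [x, Poly_Mapping.single r 1]
      \<in> J (sum_list [n, size1 r])"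
    using assms mem_carrier[OF assms(1,2)]
    by (intro compo_mem) (auto simp: valid_arities_def inputs_def Suc_le_eq simp del: comps_free_operad)
  also have "compo dual_operad [n, size1 r] (Poly_Mapping.single \<langle>\<langle>\<rangle>, f, \<langle>\<rangle>\<rangle> 1) [x, Poly_Mapping.single r 1] =
      lin_ext (\<lambda>t. Poly_Mapping.single \<langle>t, f, r\<rangle> 1) x"
  proof -
    have "listset [Poly_Mapping.keys x, {r}] = (\<lambda>t. [t, r]) ` Poly_Mapping.keys x"
      by (auto simp: set_Cons_def)
    then show ?thesis
      by (simp add: dual_operad_def compo_free_operad multilinear_ext_def lin_ext_def sum.reindex inj_on_def
          numeral_2_eq_2 lessThan_Suc)
  qed
  finally show ?thesis by simp
qed

lemma node_right_mem:
  assumes "1 \<le> n" "x \<in> J n" "f \<in> dual_basis UNIV" "labelled l"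
  shows "lin_ext (\<lambda>t. Poly_Mapping.single \<langle>l, f, t\<rangle> 1) x \<in> J (size1 l + n)"
proof -
  have "compo dual_operad [size1 l, n] (Poly_Mapping.single \<langle>\<langle>\<rangle>, f, \<langle>\<rangle>\<rangle> 1) [Poly_Mapping.single l 1, x]
      \<in> J (sum_list [size1 l, n])"
    using assms mem_carrier[OF assms(1,2)]
    by (intro compo_mem) (auto simp: valid_arities_def inputs_def Suc_le_eq simp del: comps_free_operad)
  also have "compo dual_operad [size1 l, n] (Poly_Mapping.single \<langle>\<langle>\<rangle>, f, \<langle>\<rangle>\<rangle> 1) [Poly_Mapping.single l 1, x] =
      lin_ext (\<lambda>t. Poly_Mapping.single \<langle>l, f, t\<rangle> 1) x"
  proof -
    have "listset [{l}, Poly_Mapping.keys x] = (\<lambda>t. [l, t]) ` Poly_Mapping.keys x"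
      by (auto simp: set_Cons_def)
    then show ?thesis
      by (simp add: dual_operad_def compo_free_operad multilinear_ext_def lin_ext_def sum.reindex inj_on_def
          numeral_2_eq_2 lessThan_Suc)
  qed
  finally show ?thesis by simp
qed

text \<open>Here the ideal absorbs x in the outer position, so that a relation of arity 3 can be
  used at the top of a tree with arbitrary subtrees.\<close>

lemma graft_mem:
  assumes "x \<in> J n" "n = length ts" "ts \<noteq> []" "\<forall>t\<in>set ts. labelled t"
  shows "lin_ext (\<lambda>t. Poly_Mapping.single (graft t ts) 1) x \<in> J (sum_list (map size1 ts))"
proof -
  have "compo dual_operad (map size1 ts) x (map (\<lambda>t. Poly_Mapping.single t 1) ts)
      \<in> J (sum_list (map size1 ts))"
    using assms mem_carrier[of n x]
    by (intro compo_mem)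
      (auto simp: valid_arities_def inputs_def Suc_le_eq list_all2_conv_all_nth simp del: comps_free_operad)
  then show ?thesis
    by (simp add: dual_operad_def compo_free_operad multilinear_ext_map_single)
qed

section \<open>Vanishing and congruence of trees\<close>

definition null :: "('w \<times> 'w \<Rightarrow> 'k) tree \<Rightarrow> bool" where
  "null t \<longleftrightarrow> Poly_Mapping.single t 1 \<in> J (size1 t)"

definition tree_equiv :: "('w \<times> 'w \<Rightarrow> 'k) tree \<Rightarrow> ('w \<times> 'w \<Rightarrow> 'k) tree \<Rightarrow> bool" where
  "tree_equiv s t \<longleftrightarrow> size1 s = size1 t \<and> Poly_Mapping.single s 1 - Poly_Mapping.single t 1 \<in> J (size1 t)"

lemma one_le_size1: "1 \<le> size1 t"
  by (simp add: Suc_le_eq)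

lemma equiv_refl: "tree_equiv t t"
  by (simp add: tree_equiv_def zero_mem one_le_size1 del: One_nat_def)

lemma equiv_trans [trans]: "tree_equiv s t \<Longrightarrow> tree_equiv t u \<Longrightarrow> tree_equiv s u"
  unfolding tree_equiv_def
  using add_mem[OF one_le_size1, of "Poly_Mapping.single s 1 - Poly_Mapping.single t 1" u
      "Poly_Mapping.single t 1 - Poly_Mapping.single u 1"] by simp

lemma null_if_equiv: "tree_equiv s t \<Longrightarrow> null t \<Longrightarrow> null s"
  unfolding tree_equiv_def null_def
  using add_mem[OF one_le_size1, of "Poly_Mapping.single s 1 - Poly_Mapping.single t 1" t
      "Poly_Mapping.single t 1"] by simp

lemma null_left: "\<lbrakk>null l; f \<in> dual_basis UNIV; labelled r\<rbrakk> \<Longrightarrow> null \<langle>l, f, r\<rangle>"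
  unfolding null_def using node_left_mem[OF one_le_size1, of "Poly_Mapping.single l 1" l f r] by simp

lemma null_right: "\<lbrakk>null r; f \<in> dual_basis UNIV; labelled l\<rbrakk> \<Longrightarrow> null \<langle>l, f, r\<rangle>"
  unfolding null_def using node_right_mem[OF one_le_size1, of "Poly_Mapping.single r 1" r f l] by simp

lemma equiv_left: "\<lbrakk>tree_equiv l l'; f \<in> dual_basis UNIV; labelled r\<rbrakk> \<Longrightarrow> tree_equiv \<langle>l, f, r\<rangle> \<langle>l', f, r\<rangle>"
  unfolding tree_equiv_def
  using node_left_mem[OF one_le_size1, of "Poly_Mapping.single l 1 - Poly_Mapping.single l' 1" l' f r]
  by (simp add: lin_ext_diff)

lemma equiv_right: "\<lbrakk>tree_equiv r r'; f \<in> dual_basis UNIV; labelled l\<rbrakk> \<Longrightarrow> tree_equiv \<langle>l, f, r\<rangle> \<langle>l, f, r'\<rangle>"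
  unfolding tree_equiv_def
  using node_right_mem[OF one_le_size1, of "Poly_Mapping.single r 1 - Poly_Mapping.single r' 1" r' f l]
  by (simp add: lin_ext_diff)

lemma equiv_node:
  "\<lbrakk>tree_equiv l l'; tree_equiv r r'; f \<in> dual_basis UNIV; labelled l'; labelled r\<rbrakk> \<Longrightarrow> tree_equiv \<langle>l, f, r\<rangle> \<langle>l', f, r'\<rangle>"
  by (rule equiv_trans[OF equiv_left equiv_right])

text \<open>With trivial subtrees, both trees carry exactly the word
  \<open>\<alpha> \<beta> \<gamma>\<close>, so their difference is in the kernel and hence in J; the
  subtrees are grafted afterwards. This is the rotation that leads to right combs.\<close>

lemma equiv_assoc:
  assumes "labelled t1" "labelled t2" "labelled t3"
  shows "tree_equiv \<langle>\<langle>t1, kronecker (\<alpha>, \<beta>), t2\<rangle>, kronecker (arr \<alpha> \<beta>, \<gamma>), t3\<rangle>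
    \<langle>t1, kronecker (\<alpha>, arr \<beta> \<gamma>), \<langle>t2, kronecker (\<beta>, \<gamma>), t3\<rangle>\<rangle>"
proof -
  let ?s = "\<langle>\<langle>\<langle>\<rangle>, kronecker (\<alpha>, \<beta>), \<langle>\<rangle>\<rangle>, kronecker (arr \<alpha> \<beta>, \<gamma>), \<langle>\<rangle>\<rangle> :: ('w \<times> 'w \<Rightarrow> 'k) tree"
  let ?t = "\<langle>\<langle>\<rangle>, kronecker (\<alpha>, arr \<beta> \<gamma>), \<langle>\<langle>\<rangle>, kronecker (\<beta>, \<gamma>), \<langle>\<rangle>\<rangle>\<rangle> :: ('w \<times> 'w \<Rightarrow> 'k) tree"
  let ?u = "Poly_Mapping.single ?s 1 - Poly_Mapping.single ?t 1 :: _ \<Rightarrow>\<^sub>0 'k"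
  have "matches arr ?s w \<longleftrightarrow> matches arr ?t w" for w
  proof (rule matches_3_eqI)
    show "matches arr ?s [a, b, c] \<longleftrightarrow> matches arr ?t [a, b, c]" for a b c
      unfolding matches_left_tree matches_right_tree by auto
  qed simp_all
  then have "tree_words arr ?u = 0"
    by (intro poly_mapping_eqI) (simp add: tree_words_diff lookup_minus lookup_tree_words_single)
  moreover have "?u \<in> carrier (comps dual_operad 3)"
  proof -
    have "Poly_Mapping.keys ?u \<subseteq> {?s, ?t}"
      using keys_diff[of "Poly_Mapping.single ?s (1::'k)" "Poly_Mapping.single ?t 1"]
      by (simp only: keys_single) (simp add: insert_commute)
    then show ?thesis
      unfolding dual_operad_def comps_free_operad carrier_free_space mem_Collect_eq
      by (rule order_trans) simp
  qed
  ultimately have "?u \<in> J 3"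
    by (rule relations[rotated])
  from graft_mem[OF this, of "[t1, t2, t3]"] assms show ?thesis
    by (simp add: tree_equiv_def lin_ext_diff add.assoc)
qed

text \<open>A three-leaf tree without a word lies in the kernel, hence in J, and remains there after
  grafting. It serves for a root label that contradicts the label of a child.\<close>

lemma null_if_no_match:
  fixes s :: "('w \<times> 'w \<Rightarrow> 'k) tree"
  assumes "size1 s = 3" "labelled s" "\<And>a b c. \<not> matches arr s [a, b, c]" and ts: "length ts = 3" "\<forall>t\<in>set ts. labelled t"
  shows "null (graft s ts)"
proof -
  have "\<not> matches arr s w" for w
    using assms by (metis length_3E matches_length)
  then have "tree_words arr (Poly_Mapping.single s 1) = 0"
    by (intro poly_mapping_eqI) (simp add: lookup_tree_words_single)
  then have "Poly_Mapping.single s 1 \<in> J 3"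
    using assms by (intro relations) auto
  moreover have "ts \<noteq> []" using ts(1) by auto
  ultimately have "lin_ext (\<lambda>t. Poly_Mapping.single (graft t ts) 1) (Poly_Mapping.single s 1)
      \<in> J (sum_list (map size1 ts))"
    using ts by (intro graft_mem[of _ 3]) simp_all
  then show ?thesis
    using assms(1) ts(1) by (simp add: null_def size1_graft)
qed

lemma null_left_inconsistent:
  assumes "labelled t1" "labelled t2" "labelled t3" "p \<noteq> arr \<alpha> \<beta>"
  shows "null \<langle>\<langle>t1, kronecker (\<alpha>, \<beta>), t2\<rangle>, kronecker (p, \<gamma>), t3\<rangle>"
  using null_if_no_match[of "\<langle>\<langle>\<langle>\<rangle>, kronecker (\<alpha>, \<beta>), \<langle>\<rangle>\<rangle>, kronecker (p, \<gamma>), \<langle>\<rangle>\<rangle>" "[t1, t2, t3]"] assms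
  by (auto simp: matches_left_tree simp del: matches.simps)

lemma null_right_inconsistent:
  assumes "labelled t1" "labelled t2" "labelled t3" "p \<noteq> arr \<beta> \<gamma>"
  shows "null \<langle>t1, kronecker (\<alpha>, p), \<langle>t2, kronecker (\<beta>, \<gamma>), t3\<rangle>\<rangle>"
  using null_if_no_match[of "\<langle>\<langle>\<rangle>, kronecker (\<alpha>, p), \<langle>\<langle>\<rangle>, kronecker (\<beta>, \<gamma>), \<langle>\<rangle>\<rangle>\<rangle>" "[t1, t2, t3]"] assms
  by (auto simp: matches_right_tree simp del: matches.simps)

text \<open>One rotation brings the first letter of u to the root and leaves the shorter comb of u
  beside that of v in the right subtree, where the induction hypothesis applies.\<close>

lemma right_comb_append:
  assumes "u \<noteq> []" "v \<noteq> []"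
  shows "tree_equiv \<langle>right_comb arr u, kronecker (word_value arr u, word_value arr v), right_comb arr v\<rangle>
    (right_comb arr (u @ v))"
  using assms(1)
proof (induction u)
  case (Cons \<alpha> u)
  show ?case
  proof (cases "u = []")
    case True
    then show ?thesis using assms(2) by (simp add: right_comb_Cons equiv_refl)
  next
    case False
    let ?\<beta> = "word_value arr u" and ?\<gamma> = "word_value arr v"
    have "tree_equiv \<langle>right_comb arr (\<alpha> # u), kronecker (word_value arr (\<alpha> # u), ?\<gamma>), right_comb arr v\<rangle>
        \<langle>\<langle>\<rangle>, kronecker (\<alpha>, arr ?\<beta> ?\<gamma>), \<langle>right_comb arr u, kronecker (?\<beta>, ?\<gamma>), right_comb arr v\<rangle>\<rangle>"
      using equiv_assoc[of "\<langle>\<rangle>" "right_comb arr u" "right_comb arr v" \<alpha> ?\<beta> ?\<gamma>] False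
      by (simp add: right_comb_Cons word_value_Cons[OF semigroup])
    also have "tree_equiv \<dots> \<langle>\<langle>\<rangle>, kronecker (\<alpha>, arr ?\<beta> ?\<gamma>), right_comb arr (u @ v)\<rangle>"
      using Cons.IH[OF False] by (intro equiv_right) auto
    also have "\<dots> = right_comb arr ((\<alpha> # u) @ v)"
      using False assms(2) by (simp add: right_comb_Cons word_value_append[OF semigroup])
    finally show ?thesis .
  qed
qed simp

text \<open>The word splits at the root; both subtrees reduce to combs by induction, and the two
  combs are merged by \<open>right_comb_append\<close>.\<close>

lemma equiv_right_comb:
  assumes "matches arr t w" "labelled t"
  shows "tree_equiv t (right_comb arr w)"
  using assms
proof (induction t arbitrary: w)
  case Leaf
  then show ?case by (auto simp: length_Suc_conv equiv_refl)
next
  case (Node l f r)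
  obtain u v where w: "w = u @ v" "matches arr l u" "matches arr r v"
    "f = kronecker (word_value arr u, word_value arr v)"
    using Node.prems(1) by (rule matches_nodeE)
  have ne: "u \<noteq> []" "v \<noteq> []"
    using w matches_nonempty by blast+
  have "tree_equiv \<langle>l, f, r\<rangle> \<langle>right_comb arr u, f, right_comb arr v\<rangle>"
    using Node w by (intro equiv_node) auto
  also have "tree_equiv \<dots> (right_comb arr w)"
    unfolding w(1,4) by (rule right_comb_append[OF ne])
  finally show ?case .
qed

text \<open>An unmatched subtree vanishes by induction and takes the tree with it. If both subtrees
  carry words, the conflict is at the root; after reducing them to combs, it is visible on the root
  and the top vertex of one comb.\<close>

lemma null_if_unmatched:
  assumes "labelled t" "\<And>w. \<not> matches arr t w"
  shows "null t"
  using assms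
proof (induction t)
  case Leaf
  then show ?case using Leaf(2)[of "[undefined]"] by simp
next
  case (Node l f r)
  then have lab: "labelled l" "labelled r" "f \<in> dual_basis UNIV" by auto
  then obtain a b where f: "f = kronecker (a, b)"
    by (auto simp: dual_basis_eq)
  show ?case
  proof (cases "(\<forall>w. \<not> matches arr l w) \<or> (\<forall>w. \<not> matches arr r w)")
    case True
    then show ?thesis
      using Node.IH lab null_left null_right by blast
  next
    case False
    \<comment> \<open>A trivial subtree accepts any letter, so its letter can be chosen as the root
      label demands. A conflict can then only concern a nontrivial subtree.\<close>
    have leaf: "\<exists>w. matches arr t w \<and> word_value arr w = c" if "t = \<langle>\<rangle>" for t c
      using that by (intro exI[of _ "[c]"]) simp
    obtain u where u: "matches arr l u" "l = \<langle>\<rangle> \<Longrightarrow> word_value arr u = a"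
      using False leaf by metis
    obtain v where v: "matches arr r v" "r = \<langle>\<rangle> \<Longrightarrow> word_value arr v = b"
      using False leaf by metis
    have tree_equiv: "tree_equiv \<langle>l, f, r\<rangle> \<langle>right_comb arr u, f, right_comb arr v\<rangle>"
      using u v lab by (intro equiv_node equiv_right_comb) auto
    \<comment> \<open>A nontrivial tree carries a word of at least two letters, so its comb has a
      top vertex to set against the root.\<close>
    have long: "\<exists>\<alpha> w'. w = \<alpha> # w' \<and> w' \<noteq> []" if tw: "matches arr t w" "t \<noteq> \<langle>\<rangle>"
      for t :: "('w \<times> 'w \<Rightarrow> 'k) tree" and w
    proof -
      obtain l f r where "t = \<langle>l, f, r\<rangle>" using tw(2) by (cases t) auto
      with tw(1) obtain x y where "w = x @ y" "matches arr l x" "matches arr r y"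
        by (auto elim: matches_nodeE simp del: matches.simps)
      then show ?thesis
        using matches_nonempty[of arr l x] matches_nonempty[of arr r y] by (cases x) auto
    qed
    have "word_value arr u \<noteq> a \<or> word_value arr v \<noteq> b"
      using Node.prems(2)[of "u @ v"] u(1) v(1) f matches_length[OF u(1)]
      by (auto simp: matches_node_append simp del: matches.simps)
    then have "null \<langle>right_comb arr u, f, right_comb arr v\<rangle>"
    proof
      assume neq: "word_value arr u \<noteq> a"
      then obtain \<alpha> u' where "u = \<alpha> # u'" "u' \<noteq> []"
        using u long by blast
      then show ?thesis
        using neq null_left_inconsistent[of "\<langle>\<rangle>" "right_comb arr u'" "right_comb arr v" a \<alpha> "word_value arr u'" b]
        by (simp add: f right_comb_Cons word_value_Cons[OF semigroup])
    next
      assume neq: "word_value arr v \<noteq> b"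
      then obtain \<beta> v' where "v = \<beta> # v'" "v' \<noteq> []"
        using v long by blast
      then show ?thesis
        using neq null_right_inconsistent[of "right_comb arr u" "\<langle>\<rangle>" "right_comb arr v'" b \<beta> "word_value arr v'" a]
        by (simp add: f right_comb_Cons word_value_Cons[OF semigroup])
    qed
    then show ?thesis
      using tree_equiv null_if_equiv by blast
  qed
qed

text \<open>Replacing every tree in x by the comb of its word, or by 0, changes x only modulo J. In
  the result the comb of w has the coefficient of w in \<open>tree_words arr x\<close>, which is
  0.\<close>

lemma kernel_subset:
  assumes n: "1 \<le> n" and x: "x \<in> carrier (comps dual_operad n)" and zero: "tree_words arr x = 0"
  shows "x \<in> J n"
\<comment> \<open>The trivial tree carries several words in general, so arity 1 is treated directly:
  x is a multiple of the trivial tree, and its coefficient can be read at any letter of the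
  image.\<close>
proof (cases "n = 1")
  case True
  have "Poly_Mapping.lookup x t = 0" for t
  proof (cases "t = \<langle>\<rangle>")
    case True
    have "Poly_Mapping.lookup (tree_words arr x) [undefined] = Poly_Mapping.lookup x \<langle>\<rangle>"
    proof -
      have "Poly_Mapping.keys x \<subseteq> {\<langle>\<rangle>}"
      proof
        fix t assume "t \<in> Poly_Mapping.keys x"
        then have "size1 t = 1" using x \<open>n = 1\<close> by (auto simp: dual_operad_def)
        then show "t \<in> {\<langle>\<rangle>}" by (cases t) (auto simp: size1_size)
      qed
      then show ?thesis
        unfolding tree_words_def by (subst lookup_lin_ext_superset[of "{\<langle>\<rangle>}"])
          (auto simp: lookup_sum lookup_single when_def finite_words)
    qed
    then show ?thesis using zero True by simp
  next
    case False
    then have "size1 t \<noteq> 1" by (cases t) (auto simp: size1_size)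
    then have "t \<notin> Poly_Mapping.keys x" using x \<open>n = 1\<close> by (auto simp: dual_operad_def)
    then show ?thesis by (simp add: not_in_keys_iff_lookup_eq_zero)
  qed
  then have "x = 0" by (intro poly_mapping_eqI) simp
  then show ?thesis using zero_mem[OF n] by simp
next
  case False
  \<comment> \<open>\<open>D t\<close> is t minus the comb of its word, or t itself if it carries
    none; as n is not 1, at most one term of the sum is nonzero.\<close>
  define D :: "('w \<times> 'w \<Rightarrow> 'k) tree \<Rightarrow> ('w \<times> 'w \<Rightarrow> 'k) tree \<Rightarrow>\<^sub>0 'k" where "D t = Poly_Mapping.single t 1 -
    (\<Sum>w | length w = n. Poly_Mapping.single (right_comb arr w) (of_bool (matches arr t w)))" for t
  have "D t \<in> J n" if t: "t \<in> Poly_Mapping.keys x" for t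
  proof -
    have size: "size1 t = n" and lab: "labelled t"
      using x t by (auto simp: dual_operad_def labelled_def)
    show ?thesis
    proof (cases "\<exists>w. matches arr t w")
      case True
      then obtain w where w: "matches arr t w" by blast
      have "t \<noteq> \<langle>\<rangle>" using size False by auto
      then have iff: "matches arr t v \<longleftrightarrow> v = w" for v
        using w matches_unique[OF w, of v] by metis
      have "Poly_Mapping.single (right_comb arr v) (of_bool (matches arr t v)) =
          (if v = w then Poly_Mapping.single (right_comb arr w :: ('w \<times> 'w \<Rightarrow> 'k) tree) (1::'k) else 0)" for v
        by (simp add: iff)
      then have "D t = Poly_Mapping.single t 1 - Poly_Mapping.single (right_comb arr w) 1"
        using matches_length[OF w] size by (simp add: D_def finite_words)
      then show ?thesis
        using equiv_right_comb[OF w lab] size by (simp add: tree_equiv_def)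
    next
      case False
      then have "D t = Poly_Mapping.single t 1" by (simp add: D_def)
      then show ?thesis
        using null_if_unmatched[OF lab] False size by (simp add: null_def)
    qed
  qed
  then have "lin_ext D x \<in> J n"
    unfolding lin_ext_def using n by (intro sum_mem scale_mem)
  also have "lin_ext D x = x"
  proof (rule poly_mapping_eqI)
    fix s :: "('w \<times> 'w \<Rightarrow> 'k) tree"
    let ?c = "\<lambda>w. Poly_Mapping.lookup (Poly_Mapping.single (right_comb arr w) (1::'k)) s"
    have D: "Poly_Mapping.lookup (D t) s = of_bool (t = s) -
        (\<Sum>w | length w = n. of_bool (matches arr t w) * ?c w)" for t
      unfolding D_def lookup_minus lookup_sum
      by (intro arg_cong2[where f = "(-)"] sum.cong refl) (simp_all add: lookup_single when_def)
    have "Poly_Mapping.lookup (lin_ext D x) s =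
        (\<Sum>t\<in>Poly_Mapping.keys x. Poly_Mapping.lookup x t * of_bool (t = s)) -
        (\<Sum>t\<in>Poly_Mapping.keys x. \<Sum>w | length w = n.
          Poly_Mapping.lookup x t * of_bool (matches arr t w) * ?c w)"
      by (simp only: lookup_lin_ext D right_diff_distrib sum_subtractf sum_distrib_left mult.assoc)
    \<comment> \<open>Exchanging the sums collects the trees that carry a given word, and with them
      a coefficient of \<open>tree_words arr x\<close>.\<close>
    also have "(\<Sum>t\<in>Poly_Mapping.keys x. \<Sum>w | length w = n.
          Poly_Mapping.lookup x t * of_bool (matches arr t w) * ?c w) =
        (\<Sum>w | length w = n. Poly_Mapping.lookup (tree_words arr x) w * ?c w)"
      unfolding lookup_tree_words sum_distrib_right by (rule sum.swap)
    also have "\<dots> = 0"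
      by (simp add: zero)
    also have "(\<Sum>t\<in>Poly_Mapping.keys x. Poly_Mapping.lookup x t * of_bool (t = s)) = Poly_Mapping.lookup x s"
      by (simp add: of_bool_def if_distrib not_in_keys_iff_lookup_eq_zero cong: if_cong)
    finally show "Poly_Mapping.lookup (lin_ext D x) s = Poly_Mapping.lookup x s" by simp
  qed
  finally show ?thesis .
qed

end

section \<open>The kernel and the Koszul dual\<close>

lemma scale_zero [simp]: "scale 0 x = 0" "scale c 0 = 0"
  by (rule poly_mapping_eqI; simp)+

text \<open>A \<open>module_hom\<close> is only required to respect sums and multiples; the zero is
  reached as a multiple by 0.\<close>

lemma module_hom_zero:
  assumes "f \<in> LinearCombinations.module_hom class_ring (free_space A) (free_space B)"
  shows "f 0 = 0"
proof -
  have "f (scale 0 0) = scale 0 (f 0)"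
    using assms by (simp add: LinearCombinations.module_hom_def del: scale_zero)
  then show "f 0 = 0" by simp
qed

text \<open>The image of a composite is the composite of the images, and composition in P is linear
  in each argument, so one vanishing image suffices.\<close>

lemma operad_ideal_kernel:
  fixes arr :: "'w::finite \<Rightarrow> 'w \<Rightarrow> 'w"
  assumes "semigroup arr"
  shows "operad_ideal (dual_operad :: ('k::field, _) nsop)
    (\<lambda>n. {x \<in> carrier (comps dual_operad n). tree_words arr x = 0})"
  unfolding operad_ideal_def
proof (intro conjI allI impI)
  interpret P: ns_operad "word_operad arr :: ('k, 'w list \<Rightarrow>\<^sub>0 'k) nsop"
    using assms by (rule ns_operad_word_operad)
  fix n :: nat
  let ?K = "{x \<in> carrier (comps dual_operad n). tree_words arr x = (0 :: 'w list \<Rightarrow>\<^sub>0 'k)}"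
  let ?V = "comps dual_operad n :: ('k, ('w \<times> 'w \<Rightarrow> 'k) tree \<Rightarrow>\<^sub>0 'k) module"
  have vs: "vectorspace class_ring ?V"
    by (simp add: dual_operad_def vectorspace_free_space)
  moreover have "submodule class_ring ?K ?V"
  proof (rule submodule.intro)
    show "Module.module class_ring ?V"
      using vs by (simp add: vectorspace_def)
  qed (simp_all add: dual_operad_def tree_words_add tree_words_scale keys_add_subset keys_scale_subset
      Collect_mono_iff)
  ultimately show "VectorSpace.subspace class_ring ?K ?V"
    by (rule VectorSpace.subspace.intro)
next
  interpret P: ns_operad "word_operad arr :: ('k, 'w list \<Rightarrow>\<^sub>0 'k) nsop"
    using assms by (rule ns_operad_word_operad)
  fix ks and x :: "('w \<times> 'w \<Rightarrow> 'k) tree \<Rightarrow>\<^sub>0 'k" and ys :: "(('w \<times> 'w \<Rightarrow> 'k) tree \<Rightarrow>\<^sub>0 'k) list"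
  assume *: "valid_arities ks \<and> x \<in> carrier (comps dual_operad (length ks)) \<and> inputs dual_operad ks ys \<and>
    (x \<in> {x \<in> carrier (comps dual_operad (length ks)). tree_words arr x = 0} \<or>
     (\<exists>i<length ks. ys ! i \<in> {x \<in> carrier (comps dual_operad (ks ! i)). tree_words arr x = 0}))"
  then have ks: "valid_arities ks" and x: "x \<in> carrier (comps dual_operad (length ks))"
    and ys: "inputs dual_operad ks ys" by auto
  let ?ys = "map (tree_words arr) ys"
  have x': "tree_words arr x \<in> carrier (comps (word_operad arr) (length ks))"
    using x unfolding dual_operad_def by (rule tree_words_closed)
  have ys': "inputs (word_operad arr) ks ?ys"
    using ys tree_words_closed unfolding inputs_def dual_operad_def list_all2_map2 by (rule list_all2_mono)
  have "compo (word_operad arr) ks (tree_words arr x) ?ys = 0"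
  proof (cases "tree_words arr x = 0")
    case True
    then show ?thesis
      using module_hom_zero[OF P.linear_outer[OF ks ys', unfolded comps_word_operad]] by simp
  next
    case False
    with * obtain i where i: "i < length ks" "tree_words arr (ys ! i) = 0" by auto
    \<comment> \<open>The list is put in the form to which linearity in the i-th argument
      applies.\<close>
    then have "?ys[i := 0] = ?ys"
      using inputs_length[OF ys] by (metis list_update_id nth_map)
    then show ?thesis
      using module_hom_zero[OF P.linear_inner[OF ks x' ys' i(1), unfolded comps_word_operad]] by simp
  qed
  then show "compo dual_operad ks x ys \<in>
      {x \<in> carrier (comps dual_operad (sum_list ks)). tree_words arr x = 0}"
    using compo_free_operad_closed[of x "dual_basis UNIV" ks ys] x ys
      tree_words_compo[OF assms, of x "dual_basis UNIV" ks ys]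
    unfolding dual_operad_def by (simp del: comps_free_operad)
qed

definition koszul_ideal ::
    "('w::finite \<Rightarrow> 'w \<Rightarrow> 'w) \<Rightarrow> nat \<Rightarrow> (('w \<times> 'w \<Rightarrow> 'k::field) tree \<Rightarrow>\<^sub>0 'k) set" where
  "koszul_ideal arr = ideal_generated dual_operad
    (\<lambda>n. if n = 3 then orthogonal UNIV (snd (As2_presentation arr)) else {})"

lemma koszul_dual_As2:
  "koszul_dual (As2_presentation arr) = quotient_operad dual_operad (koszul_ideal arr)"
  unfolding koszul_dual_def presented_operad_def koszul_ideal_def dual_operad_def As2_presentation_def
  by (simp only: prod.case snd_conv)

text \<open>The kernel is one of the ideals in the intersection, which gives one inclusion; by
  \<open>kernel_subset\<close> it lies in all of them, which gives the other.\<close>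

lemma koszul_ideal_eq_kernel:
  fixes arr :: "'w::finite \<Rightarrow> 'w \<Rightarrow> 'w"
  assumes "semigroup arr" "1 \<le> n"
  shows "(koszul_ideal arr n :: (('w \<times> 'w \<Rightarrow> 'k::field) tree \<Rightarrow>\<^sub>0 'k) set) =
    {x \<in> carrier (comps dual_operad n). tree_words arr x = 0}"
proof
  let ?K = "\<lambda>n. {x \<in> carrier (comps dual_operad n). tree_words arr x = (0 :: 'w list \<Rightarrow>\<^sub>0 'k)}"
  have orthogonal: "orthogonal UNIV (snd (As2_presentation arr)) = ?K 3"
    unfolding dual_operad_def by (rule orthogonal_As2)
  show "koszul_ideal arr n \<subseteq> ?K n"
    unfolding koszul_ideal_def ideal_generated_def
  proof (rule Inter_lower, rule CollectI, rule exI[of _ ?K], intro conjI refl operad_ideal_kernel assms(1))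
    show "\<forall>m\<ge>1. (if m = 3 then orthogonal UNIV (snd (As2_presentation arr)) else {}) \<subseteq> ?K m"
      using orthogonal by simp
  qed
  show "?K n \<subseteq> koszul_ideal arr n"
    unfolding koszul_ideal_def ideal_generated_def
  proof (rule subsetI, rule InterI)
    fix x :: "('w \<times> 'w \<Rightarrow> 'k) tree \<Rightarrow>\<^sub>0 'k" and A :: "(('w \<times> 'w \<Rightarrow> 'k) tree \<Rightarrow>\<^sub>0 'k) set"
    assume x: "x \<in> ?K n" and "A \<in> {J n |J. operad_ideal dual_operad J \<and>
      (\<forall>m\<ge>1. (if m = 3 then orthogonal UNIV (snd (As2_presentation arr)) else {}) \<subseteq> J m)}"
    then obtain J where J: "A = J n" "operad_ideal dual_operad J"
      "\<forall>m\<ge>1. (if m = 3 then orthogonal UNIV (snd (As2_presentation arr)) else {}) \<subseteq> J m"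
      by (elim CollectE exE conjE)
    have "?K 3 \<subseteq> J 3"
      using J(3)[rule_format, of 3] orthogonal by simp
    then interpret relation_ideal arr J
      using assms(1) J(2) by (intro relation_ideal.intro) (simp_all add: subset_iff)
    show "x \<in> A"
      using assms(2) x kernel_subset[of n x] J(1) by simp
  qed
qed

section \<open>The suboperad\<close>

text \<open>Only arity 1 is restricted, and a composite of arity 1 is a multiple of the unit
  composed with another.\<close>

lemma suboperad_word_suboperad:
  fixes arr :: "'w::finite \<Rightarrow> 'w \<Rightarrow> 'w"
  assumes "semigroup arr"
  shows "suboperad (word_operad arr :: ('k::field, 'w list \<Rightarrow>\<^sub>0 'k) nsop) (word_suboperad arr)"
proof -
  interpret P: ns_operad "word_operad arr :: ('k, 'w list \<Rightarrow>\<^sub>0 'k) nsop"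
    using assms by (rule ns_operad_word_operad)
  let ?P = "word_operad arr :: ('k, 'w list \<Rightarrow>\<^sub>0 'k) nsop" and ?I = "oper_unit (word_operad arr) :: 'w list \<Rightarrow>\<^sub>0 'k"
  let ?S = "word_suboperad arr :: nat \<Rightarrow> ('w list \<Rightarrow>\<^sub>0 'k) set"
  have S1: "?S 1 = range (\<lambda>c. scale c ?I)"
    by (auto simp: word_suboperad_def)
  have S: "?S n = carrier (comps ?P n)" if "n \<noteq> 1" for n
    using that by (simp add: word_suboperad_def)
  have scale_add: "scale c ?I + scale d ?I = scale (c + d) ?I" and scale_scale: "scale c (scale d ?I) = scale (c * d) ?I"
    for c d
    by (auto simp: lookup_add algebra_simps intro!: poly_mapping_eqI)
  have "VectorSpace.subspace class_ring (?S n) (comps ?P n)" if "1 \<le> n" for n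
  proof (rule VectorSpace.subspace.intro[OF P.vectorspace_comps[OF that]])
    have module: "Module.module class_ring (comps ?P n)"
      using P.vectorspace_comps[OF that] by (simp add: vectorspace_def)
    show "submodule class_ring (?S n) (comps ?P n)"
    proof (cases "n = 1")
      case True
      show ?thesis
        unfolding True S1
      proof (rule submodule.intro)
        show "range (\<lambda>c. scale c ?I) \<subseteq> carrier (comps ?P 1)"
          using P.unit_closed by (auto simp: keys_scale_subset dest: subsetD[OF keys_scale])
        show "\<zero>\<^bsub>comps ?P 1\<^esub> \<in> range (\<lambda>c. scale c ?I)"
          by (intro range_eqI[of _ _ 0] poly_mapping_eqI) simp
      qed (use module True in \<open>auto simp: scale_add scale_scale\<close>)
    next
      case False
      show ?thesis
        unfolding S[OF False]
        by (rule submodule.intro[OF module]) (auto simp: keys_scale_subset dest: subsetD[OF Poly_Mapping.keys_add] subsetD[OF keys_scale])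
    qed
  qed
  moreover have "?I \<in> ?S 1"
    unfolding S1 by (intro range_eqI[of _ _ 1] poly_mapping_eqI) simp
  moreover have "compo ?P ks x ys \<in> ?S (sum_list ks)"
    if ks: "valid_arities ks" and x: "x \<in> ?S (length ks)" and ys: "list_all2 (\<lambda>k y. y \<in> ?S k) ks ys" for ks x ys
  proof -
    have sub: "?S k \<subseteq> carrier (comps ?P k)" for k
      using P.unit_closed S[of k] S1 by (cases "k = 1") (auto dest: subsetD[OF keys_scale])
    have inputs: "inputs ?P ks ys"
      unfolding inputs_def by (rule list_all2_mono[OF ys]) (use sub in blast)
    show ?thesis
    proof (cases "sum_list ks = 1")
      case True
      \<comment> \<open>All arities are positive, so a composite of arity 1 has a single argument,
        itself of arity 1.\<close>
      then have ks1: "ks = [1]"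
        using ks by (cases ks; cases "tl ks") (auto simp: valid_arities_def)
      then obtain y where y: "ys = [y]" "y \<in> ?S 1"
        using ys by (auto simp: list_all2_Cons1)
      obtain c where c: "x = scale c ?I"
        using x ks1 S1 by auto
      have yc: "y \<in> carrier (comps ?P 1)" using y sub by blast
      have "compo ?P [1] (scale c ?I) [y] = scale c (compo ?P [1] ?I [y])"
        using P.linear_outer[of "[1]" "[y]"] ks inputs P.unit_closed unfolding ks1 y(1)
        by (simp add: LinearCombinations.module_hom_def)
      also have "\<dots> = scale c y"
        using P.unit_left[OF _ yc] by simp
      also have "\<dots> \<in> ?S 1"
        using y(2) unfolding S1 by (auto simp: scale_scale)
      finally show ?thesis using ks1 y c by simp
    next
      case False
      then show ?thesis
        unfolding S[OF False] using P.compo_closed[OF ks _ inputs] x sub by blast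
    qed
  qed
  ultimately show ?thesis
    unfolding suboperad_def by blast
qed

text \<open>The trivial tree is the only tree with one leaf, so the image in arity 1 consists of
  multiples of the unit.\<close>

lemma tree_words_in_word_suboperad:
  assumes "x \<in> carrier (comps dual_operad n)"
  shows "tree_words arr x \<in> word_suboperad arr n"
proof (cases "n = 1")
  case True
  have "tree_words arr x = scale (Poly_Mapping.lookup x \<langle>\<rangle>) (oper_unit (word_operad arr))"
  proof (rule poly_mapping_eqI)
    fix w
    have "Poly_Mapping.keys x \<subseteq> {\<langle>\<rangle>}"
    proof
      fix t assume "t \<in> Poly_Mapping.keys x"
      then have "size1 t = 1" using assms True by (auto simp: dual_operad_def)
      then show "t \<in> {\<langle>\<rangle>}" by (cases t) (auto simp: size1_size)
    qed
    then have "Poly_Mapping.lookup (tree_words arr x) w =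
        (\<Sum>t\<in>{\<langle>\<rangle>}. Poly_Mapping.lookup x t * of_bool (matches arr t w))"
      unfolding lookup_tree_words
      by (intro sum.mono_neutral_left) (auto simp: not_in_keys_iff_lookup_eq_zero[symmetric])
    then show "Poly_Mapping.lookup (tree_words arr x) w =
        Poly_Mapping.lookup (scale (Poly_Mapping.lookup x \<langle>\<rangle>) (oper_unit (word_operad arr))) w"
      by (simp add: lookup_unit_word_operad)
  qed
  then show ?thesis using True by (auto simp: word_suboperad_def)
next
  case False
  then show ?thesis
    using tree_words_closed[of x "dual_basis UNIV" n arr] assms by (simp add: word_suboperad_def dual_operad_def)
qed

text \<open>From arity 2 on, the right comb of w goes to w alone; in arity 1 the trivial tree goes
  to the unit.\<close>

lemma tree_words_surj:
  fixes y :: "'w::finite list \<Rightarrow>\<^sub>0 'k::field"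
  assumes "1 \<le> n" "y \<in> word_suboperad arr n"
  shows "\<exists>x\<in>carrier (comps dual_operad n). tree_words arr x = y"
proof (cases "n = 1")
  case True
  then obtain c where "y = scale c (oper_unit (word_operad arr))"
    using assms by (auto simp: word_suboperad_def)
  then show ?thesis
    using True
    by (intro bexI[of _ "scale c (Poly_Mapping.single \<langle>\<rangle> 1)"])
      (simp_all only: tree_words_scale tree_words_unit, simp add: dual_operad_def)
next
  case False
  with assms have n: "2 \<le> n" and y: "Poly_Mapping.keys y \<subseteq> {w. length w = n}"
    by (auto simp: word_suboperad_def)
  let ?x = "lin_ext (\<lambda>w. Poly_Mapping.single (right_comb arr w) 1) y :: ('w \<times> 'w \<Rightarrow> 'k) tree \<Rightarrow>\<^sub>0 'k"
  have "Poly_Mapping.keys (scale c (Poly_Mapping.single (right_comb arr w :: ('w \<times> 'w \<Rightarrow> 'k) tree) (1::'k)))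
      \<subseteq> {t. size1 t = n \<and> set_tree t \<subseteq> dual_basis UNIV}" if "w \<in> Poly_Mapping.keys y" for c w
  proof -
    have "length w = n" using that y by blast
    then have "size1 (right_comb arr w :: ('w \<times> 'w \<Rightarrow> 'k) tree) = n"
      using n by (subst size1_right_comb) auto
    then show ?thesis
      using set_tree_right_comb[of arr w] by (intro keys_scale_subset) simp
  qed
  then have "?x \<in> carrier (comps dual_operad n)"
    unfolding dual_operad_def comps_free_operad carrier_free_space mem_Collect_eq lin_ext_def
    by (intro order_trans[OF keys_sum] UN_least)
  moreover have "tree_words arr ?x = y"
  proof (rule poly_mapping_eqI)
    fix v
    have "Poly_Mapping.lookup (tree_words arr ?x) v =
        (\<Sum>w\<in>Poly_Mapping.keys y. Poly_Mapping.lookup y w *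
          of_bool (matches arr (right_comb arr w :: ('w \<times> 'w \<Rightarrow> 'k) tree) v))"
      unfolding lin_ext_def tree_words_sum tree_words_scale lookup_sum lookup_scale lookup_tree_words_single ..
    also have "\<dots> = (\<Sum>w\<in>Poly_Mapping.keys y. if w = v then Poly_Mapping.lookup y w else 0)"
    proof (rule sum.cong[OF refl])
      fix w assume "w \<in> Poly_Mapping.keys y"
      then have "2 \<le> length w" using y n by auto
      from matches_right_comb_iff[OF this, where 'k = 'k, of arr v]
      show "Poly_Mapping.lookup y w * of_bool (matches arr (right_comb arr w :: ('w \<times> 'w \<Rightarrow> 'k) tree) v) =
          (if w = v then Poly_Mapping.lookup y w else 0)"
        by auto
    qed
    also have "\<dots> = Poly_Mapping.lookup y v"
      by (simp add: not_in_keys_iff_lookup_eq_zero)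
    finally show "Poly_Mapping.lookup (tree_words arr ?x) v = Poly_Mapping.lookup y v" .
  qed
  ultimately show ?thesis by blast
qed

text \<open>The first isomorphism theorem for \<open>tree_words\<close>, whose image is P_0 and
  whose kernel is the ideal that defines the Koszul dual.\<close>

lemma word_suboperad_iso_koszul_dual:
  fixes arr :: "'w::finite \<Rightarrow> 'w \<Rightarrow> 'w"
  assumes arr: "semigroup arr"
  shows "operad_isomorphic (restrict_operad (word_operad arr :: ('k::field, 'w list \<Rightarrow>\<^sub>0 'k) nsop) (word_suboperad arr))
    (koszul_dual (As2_presentation arr))"
proof -
  let ?P0 = "restrict_operad (word_operad arr :: ('k, 'w list \<Rightarrow>\<^sub>0 'k) nsop) (word_suboperad arr)"
  let ?F = "dual_operad :: ('k, ('w \<times> 'w \<Rightarrow> 'k) tree \<Rightarrow>\<^sub>0 'k) nsop"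
  have "operad_iso ?P0 (quotient_operad ?F (koszul_ideal arr))
      (\<lambda>n. fibre (tree_words arr) (carrier (comps ?F n)))"
  proof (rule quotient_operad_iso)
    show "ns_operad ?P0"
      using arr by (intro ns_operad_restrict_operad ns_operad_word_operad suboperad_word_suboperad)
    show "vectorspace class_ring (comps ?F n)" for n
      by (simp add: dual_operad_def vectorspace_free_space)
    show "oper_unit ?F \<in> carrier (comps ?F 1)"
      by (simp add: dual_operad_def)
    show "compo ?F ks x ys \<in> carrier (comps ?F (sum_list ks))"
      if "x \<in> carrier (comps ?F (length ks))" "inputs ?F ks ys" for ks x ys
      using that unfolding dual_operad_def by (rule compo_free_operad_closed)
    show "tree_words arr \<in> LinearCombinations.module_hom class_ring (comps ?F n) (comps ?P0 n)" for n
      using tree_words_in_word_suboperad[of _ n arr]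
      by (auto simp: LinearCombinations.module_hom_def dual_operad_def tree_words_add tree_words_scale)
    show "tree_words arr ` carrier (comps ?F n) = carrier (comps ?P0 n)" if "1 \<le> n" for n
      using tree_words_in_word_suboperad[of _ n arr] tree_words_surj[OF that, of _ arr]
      by (force simp del: comps_free_operad)
    show "tree_words arr (oper_unit ?F) = oper_unit ?P0"
      by (simp add: dual_operad_def tree_words_unit)
    show "tree_words arr (compo ?F ks x ys) =
        compo ?P0 ks (tree_words arr x) (map2 (\<lambda>n. tree_words arr) ks ys)"
      if "x \<in> carrier (comps ?F (length ks))" "inputs ?F ks ys" for ks x ys
    proof -
      have "map2 (\<lambda>n. tree_words arr) ks ys = map (tree_words arr) ys"
        using inputs_length[OF that(2)] by (intro nth_equalityI) auto
      then show ?thesis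
        using tree_words_compo[OF arr] that by (simp add: dual_operad_def)
    qed
    show "koszul_ideal arr n = {x \<in> carrier (comps ?F n). tree_words arr x = \<zero>\<^bsub>comps ?P0 n\<^esub>}"
      if "1 \<le> n" for n
      using koszul_ideal_eq_kernel[OF arr that, where 'k = 'k] by simp
  qed
  then show ?thesis
    unfolding operad_isomorphic_def koszul_dual_As2 by blast
qed

theorem proposition1p7:
  fixes arr :: "'w::finite \<Rightarrow> 'w \<Rightarrow> 'w"
    and P :: "('k::field, 'w list \<Rightarrow>\<^sub>0 'k) nsop"
  assumes "semigroup arr"
    and "P = word_operad arr"
  shows "ns_operad P
    \<and> (\<forall>as bss. as \<noteq> [] \<and> length bss = length as \<and> (\<forall>bs\<in>set bss. bs \<noteq> []) \<longrightarrow>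
         compo P (map length bss) (Poly_Mapping.single as 1) (map (\<lambda>bs. Poly_Mapping.single bs 1) bss) =
         scale (\<Prod>i<length as. if as ! i = word_value arr (bss ! i) then 1 else 0)
           (Poly_Mapping.single (concat bss) 1))
    \<and> oper_unit P = (\<Sum>\<alpha>\<in>UNIV. Poly_Mapping.single [\<alpha>] 1)
    \<and> suboperad P (word_suboperad arr)
    \<and> operad_isomorphic (restrict_operad P (word_suboperad arr))
         (koszul_dual (As2_presentation arr))"
proof -
  have "compo P (map length bss) (Poly_Mapping.single as 1) (map (\<lambda>bs. Poly_Mapping.single bs 1) bss) =
      scale (\<Prod>i<length as. if as ! i = word_value arr (bss ! i) then 1 else 0)
        (Poly_Mapping.single (concat bss) 1)" for as bss
    by (rule poly_mapping_eqI)
      (simp add: assms(2) compo_word_operad multilinear_ext_single of_bool_def lookup_single when_def)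
  then show ?thesis
    unfolding assms(2)
    using ns_operad_word_operad[OF assms(1)] oper_unit_word_operad suboperad_word_suboperad[OF assms(1)]
      word_suboperad_iso_koszul_dual[OF assms(1)]
    by blast
qed

end
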